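(* Let $W$ be a weight matrix of size $N$ that is Darboux-equivalent to $\tilde W=w_1\oplus\cdots\oplus w_N$, where $w_1,\dots,w_N$ are classical scalar weights. Then $W$ can be obtained as a Darboux transformation of $\tilde W$ by factoring a differential operator in the center of $\mathcal D(\tilde W)$; that is, there exist degree-preserving operators $\mathcal V,\mathcal N\in\operatorname{Mat}_N(\Omega[x])$ and matrices $A_n\in\operatorname{Mat}_N(\mathbb C)$ such that $\mathcal V\mathcal N\in\mathcal Z(\tilde W)$ and $\tilde P_n\cdot\mathcal V=A_nP_n$ for all $n\in\mathbb N_0$, where $\{P_n\}$ and $\{\tilde P_n\}$ are the sequences of monic orthogonal polynomials of $W$ and $\tilde W$ respectively.
   Context: A weight matrix $W$ of size $N$ on an interval $(x_0,x_1)$ is a smooth function $W:(x_0,x_1)\to\operatorname{Mat}_N(\mathbb C)$, positive definite almost everywhere, with finite moments of all orders. Standing assumption: for each integer $n\ge0$ the derivative $W^{(n)}(x)$ decreases exponentially at infinity and there is a scalar polynomial $p_n(x)$ such that $W^{(n)}(x)p_n(x)$ has finite moments. The sesquilinear form is $\langle P,Q\rangle_W=\int_{x_0}^{x_1}P(x)W(x)Q(x)^*dx$ on $\operatorname{Mat}_N(\mathbb C[x])$. There is a unique sequence of monic matrix polynomials $P_n$ ($\deg P_n=n$, leading coefficient $I$) with $\langle P_n,P_m\rangle_W=0$ for $n\ne m$. $\operatorname{Mat}_N(\Omega[x])$ is the algebra of matrix differential operators $D=\sum_{j=0}^m\partial^jF_j(x)$, $F_j\in\operatorname{Mat}_N(\mathbb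 C[x])$, acting on the right: $P\cdot D=\sum_j \partial^j(P)(x)F_j(x)$; products satisfy $P\cdot(D_1D_2)=(P\cdot D_1)\cdot D_2$. $\mathcal D(W)=\{D\in\operatorname{Mat}_N(\Omega[x]): \text{for all } n\ge0,\ P_n\cdot D=\Lambda_n(D)P_n\text{ for some }\Lambda_n(D)\in\operatorname{Mat}_N(\mathbb C)\}$, and $\mathcal Z(W)$ denotes the center of $\mathcal D(W)$. An operator $\mathcal V\in\operatorname{Mat}_N(\Omega[x])$ is degree-preserving if $\deg(P\cdot\mathcal V)=\deg P$ for all $P\in\operatorname{Mat}_N(\mathbb C[x])$. For weights $W_1,W_2$ of size $N$ supported on the same interval, with monic orthogonal polynomials $P_n^{(1)},P_n^{(2)}$, $W_2$ is a Darboux transformation of $W_1$ if there is $D\in\mathcal D(W_1)$ that factors as $D=\mathcal V\mathcal N$ with $\mathcal V,\mathcal N$ degree-preserving and $P_n^{(1)}\cdot\mathcal V=A_nP_n^{(2)}$ for all $n\in\mathbb N_0$, for some $A_n\in\operatorname{Mat}_N(\mathbb C)$. This is an equivalence relation, called Darboux equivalence. Classical scalar weights: the shifted Hermite weights $w_b(x)=e^{-x^2+2bx}$ on $(-\infty,\infty)$ ($b\in\mathbb R$), the Laguerre weights $w_\alpha(x)=e^{-x}x^\alpha$ on $(0,\infty)$ ($\alpha>-1$), and the Jacobi weights $w_{\alpha,\beta}(x)=(1-x)^\alpha(1+x)^\beta$ on $(-1,1)$ ($\alpha,\beta>-1$). Since $\tilde W$ is a weight matrix on one interval, $w_1,\dots,w_N$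 are supported on the same interval (hence are of the same type). $w_1\oplus\cdots\oplus w_N$ is the diagonal matrix with these entries. *)

theory Defs
  imports "HOL-Analysis.Analysis" "HOL-Computational_Algebra.Polynomial"
    "HOL-Library.Landau_Symbols"
begin

text \<open>
  The size \<open>N\<close> of the matrices is \<open>CARD('n)\<close>. Matrix products are \<open>(**)\<close>; the operations
  \<open>*\<close> and \<open>1\<close> on the type of matrices are entrywise in the library and are not used.
\<close>

type_synonym 'n cmat = "complex ^ 'n ^ 'n"
type_synonym 'n mpoly = "complex poly ^ 'n ^ 'n"
type_synonym 'n mdiffop = "'n mpoly \<Rightarrow> 'n mpoly"

definition adjoint_mat :: "'n::finite cmat \<Rightarrow> 'n cmat" where
  "adjoint_mat A = transpose (map_matrix cnj A)"

definition positive_definite :: "'n::finite cmat \<Rightarrow> bool" where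
  "positive_definite A \<longleftrightarrow> adjoint_mat A = A \<and>
     (\<forall>v. v \<noteq> 0 \<longrightarrow> 0 < Re (\<Sum>i\<in>UNIV. \<Sum>j\<in>UNIV. cnj (v $ i) * A $ i $ j * v $ j))"


section \<open>Weight matrices\<close>

definition nth_deriv :: "nat \<Rightarrow> (real \<Rightarrow> 'n::finite cmat) \<Rightarrow> real \<Rightarrow> 'n cmat" where
  "nth_deriv n W = ((\<lambda>G x. vector_derivative G (at x)) ^^ n) W"

definition smooth_on_interval :: "ereal \<Rightarrow> ereal \<Rightarrow> (real \<Rightarrow> 'n::finite cmat) \<Rightarrow> bool" where
  "smooth_on_interval x0 x1 W \<longleftrightarrow>
     (\<forall>n. \<forall>x\<in>einterval x0 x1. nth_deriv n W differentiable (at x))"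

definition finite_moments :: "ereal \<Rightarrow> ereal \<Rightarrow> (real \<Rightarrow> 'n::finite cmat) \<Rightarrow> bool" where
  "finite_moments x0 x1 G \<longleftrightarrow>
     (\<forall>k::nat. set_integrable lborel (einterval x0 x1) (\<lambda>x. x ^ k *\<^sub>R G x))"

text \<open>The condition only bites at the infinite endpoints of the interval.\<close>

definition exp_decay_at_infinity :: "ereal \<Rightarrow> ereal \<Rightarrow> (real \<Rightarrow> 'n::finite cmat) \<Rightarrow> bool" where
  "exp_decay_at_infinity x0 x1 G \<longleftrightarrow>
     (x1 = \<infinity> \<longrightarrow> (\<exists>c>0. (\<lambda>x. norm (G x)) \<in> O[at_top](\<lambda>x. exp (- c * \<bar>x\<bar>)))) \<and>
     (x0 = -\<infinity> \<longrightarrow> (\<exists>c>0. (\<lambda>x. norm (G x)) \<in> O[at_bot](\<lambda>x. exp (- c * \<bar>x\<bar>))))"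

text \<open>
  A weight is a total function of which only the values on the interval matter. The requirement
  \<open>p \<noteq> 0\<close> keeps the last condition from being void.
\<close>

definition weight_matrix :: "ereal \<Rightarrow> ereal \<Rightarrow> (real \<Rightarrow> 'n::finite cmat) \<Rightarrow> bool" where
  "weight_matrix x0 x1 W \<longleftrightarrow>
     x0 < x1 \<and>
     smooth_on_interval x0 x1 W \<and>
     (AE x in lborel. x \<in> einterval x0 x1 \<longrightarrow> positive_definite (W x)) \<and>
     finite_moments x0 x1 W \<and>
     (\<forall>n. exp_decay_at_infinity x0 x1 (nth_deriv n W) \<and>
          (\<exists>p::complex poly. p \<noteq> 0 \<and>
             finite_moments x0 x1
               (\<lambda>x. map_matrix (\<lambda>z. z * poly p (of_real x)) (nth_deriv n W x))))"


section \<open>Matrix polynomials and monic orthogonal polynomials\<close>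

definition const_mpoly :: "'n::finite cmat \<Rightarrow> 'n mpoly" where
  "const_mpoly A = map_matrix (\<lambda>c. [:c:]) A"

definition mpoly_coeff :: "'n::finite mpoly \<Rightarrow> nat \<Rightarrow> 'n cmat" where
  "mpoly_coeff P k = map_matrix (\<lambda>p. coeff p k) P"

definition mpoly_eval :: "'n::finite mpoly \<Rightarrow> real \<Rightarrow> 'n cmat" where
  "mpoly_eval P x = map_matrix (\<lambda>p. poly p (of_real x)) P"

text \<open>The degree in \<open>x\<close> of a nonzero matrix polynomial; the value \<open>0\<close> at \<open>P = 0\<close> is a dummy.\<close>

definition mpoly_degree :: "'n::finite mpoly \<Rightarrow> nat" where
  "mpoly_degree P = Max {degree (P $ i $ j) | i j. True}"

definition sesq_form ::
    "ereal \<Rightarrow> ereal \<Rightarrow> (real \<Rightarrow> 'n::finite cmat) \<Rightarrow> 'n mpoly \<Rightarrow> 'n mpoly \<Rightarrow> 'n cmat" where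
  "sesq_form x0 x1 W P Q =
     (LINT x:einterval x0 x1|lborel. mpoly_eval P x ** W x ** adjoint_mat (mpoly_eval Q x))"

definition monic_orthogonal ::
    "ereal \<Rightarrow> ereal \<Rightarrow> (real \<Rightarrow> 'n::finite cmat) \<Rightarrow> (nat \<Rightarrow> 'n mpoly) \<Rightarrow> bool" where
  "monic_orthogonal x0 x1 W P \<longleftrightarrow>
     (\<forall>n. mpoly_degree (P n) = n \<and> mpoly_coeff (P n) n = mat 1) \<and>
     (\<forall>n m. n \<noteq> m \<longrightarrow> sesq_form x0 x1 W (P n) (P m) = 0)"

text \<open>For a weight matrix the sequence exists and is unique.\<close>

definition monic_ops :: "ereal \<Rightarrow> ereal \<Rightarrow> (real \<Rightarrow> 'n::finite cmat) \<Rightarrow> nat \<Rightarrow> 'n mpoly" where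
  "monic_ops x0 x1 W = (THE P. monic_orthogonal x0 x1 W P)"


section \<open>Matrix differential operators\<close>

text \<open>
  The operator \<open>D = (\<Sum>j\<le>m. \<partial>^j F\<^sub>j)\<close> is represented by its right action \<open>P \<mapsto> P \<cdot> D\<close> on matrix
  polynomials, which determines the coefficients \<open>F\<^sub>j\<close>. Application \<open>D P\<close> is therefore \<open>P \<cdot> D\<close>, and
  the product \<open>D\<^sub>1 D\<^sub>2\<close>, for which \<open>P \<cdot> (D\<^sub>1 D\<^sub>2) = (P \<cdot> D\<^sub>1) \<cdot> D\<^sub>2\<close>, is the composition in
  reverse order.
\<close>

definition diff_ops :: "'n::finite mdiffop set" where
  "diff_ops = {D. \<exists>(m::nat) (F :: nat \<Rightarrow> 'n mpoly).
     \<forall>P. D P = (\<Sum>j\<le>m. map_matrix (pderiv ^^ j) P ** F j)}"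

definition op_prod :: "'n::finite mdiffop \<Rightarrow> 'n mdiffop \<Rightarrow> 'n mdiffop" where
  "op_prod D1 D2 = (\<lambda>P. D2 (D1 P))"

text \<open>
  The zero polynomial has degree \<open>-\<infinity>\<close>, so a degree-preserving operator annihilates no nonzero
  polynomial; for \<open>P = 0\<close> the condition holds by linearity.
\<close>

definition degree_preserving :: "'n::finite mdiffop \<Rightarrow> bool" where
  "degree_preserving V \<longleftrightarrow> V \<in> diff_ops \<and>
     (\<forall>P. P \<noteq> 0 \<longrightarrow> V P \<noteq> 0 \<and> mpoly_degree (V P) = mpoly_degree P)"

definition D_algebra :: "ereal \<Rightarrow> ereal \<Rightarrow> (real \<Rightarrow> 'n::finite cmat) \<Rightarrow> 'n mdiffop set" where
  "D_algebra x0 x1 W = {D \<in> diff_ops.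
     \<forall>n. \<exists>L. D (monic_ops x0 x1 W n) = const_mpoly L ** monic_ops x0 x1 W n}"

definition D_center :: "ereal \<Rightarrow> ereal \<Rightarrow> (real \<Rightarrow> 'n::finite cmat) \<Rightarrow> 'n mdiffop set" where
  "D_center x0 x1 W = {D \<in> D_algebra x0 x1 W.
     \<forall>E \<in> D_algebra x0 x1 W. op_prod D E = op_prod E D}"


section \<open>Darboux transformations\<close>

text \<open>\<open>darboux_transformation x0 x1 W1 W2\<close>: \<open>W2\<close> is a Darboux transformation of \<open>W1\<close>.\<close>

definition darboux_transformation ::
    "ereal \<Rightarrow> ereal \<Rightarrow> (real \<Rightarrow> 'n::finite cmat) \<Rightarrow> (real \<Rightarrow> 'n cmat) \<Rightarrow> bool" where
  "darboux_transformation x0 x1 W1 W2 \<longleftrightarrow>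
     weight_matrix x0 x1 W1 \<and> weight_matrix x0 x1 W2 \<and>
     (\<exists>D \<in> D_algebra x0 x1 W1. \<exists>V N (A :: nat \<Rightarrow> 'n cmat).
        degree_preserving V \<and> degree_preserving N \<and> D = op_prod V N \<and>
        (\<forall>n. V (monic_ops x0 x1 W1 n) = const_mpoly (A n) ** monic_ops x0 x1 W2 n))"

text \<open>
  The relation above is itself an equivalence relation on the weights of the interval (for symmetry,
  \<open>A n\<close> is invertible because \<open>V\<close> preserves degrees), so no closure is taken.
\<close>

definition darboux_equivalent ::
    "ereal \<Rightarrow> ereal \<Rightarrow> (real \<Rightarrow> 'n::finite cmat) \<Rightarrow> (real \<Rightarrow> 'n cmat) \<Rightarrow> bool" where
  "darboux_equivalent x0 x1 W W' \<longleftrightarrow> darboux_transformation x0 x1 W' W"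


section \<open>Classical scalar weights and direct sums\<close>

definition hermite_weight :: "real \<Rightarrow> real \<Rightarrow> real" where
  "hermite_weight b x = exp (- x\<^sup>2 + 2 * b * x)"

definition laguerre_weight :: "real \<Rightarrow> real \<Rightarrow> real" where
  "laguerre_weight \<alpha> x = exp (- x) * x powr \<alpha>"

definition jacobi_weight :: "real \<Rightarrow> real \<Rightarrow> real \<Rightarrow> real" where
  "jacobi_weight \<alpha> \<beta> x = (1 - x) powr \<alpha> * (1 + x) powr \<beta>"

definition classical_weight :: "ereal \<Rightarrow> ereal \<Rightarrow> (real \<Rightarrow> real) \<Rightarrow> bool" where
  "classical_weight x0 x1 w \<longleftrightarrow>
     (x0 = -\<infinity> \<and> x1 = \<infinity> \<and> (\<exists>b. \<forall>x\<in>einterval x0 x1. w x = hermite_weight b x)) \<or>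
     (x0 = 0 \<and> x1 = \<infinity> \<and>
        (\<exists>\<alpha>>-1. \<forall>x\<in>einterval x0 x1. w x = laguerre_weight \<alpha> x)) \<or>
     (x0 = -1 \<and> x1 = 1 \<and>
        (\<exists>\<alpha>>-1. \<exists>\<beta>>-1. \<forall>x\<in>einterval x0 x1. w x = jacobi_weight \<alpha> \<beta> x))"

definition direct_sum_weight :: "('n::finite \<Rightarrow> real \<Rightarrow> real) \<Rightarrow> real \<Rightarrow> 'n cmat" where
  "direct_sum_weight w x = (\<chi> i j. if i = j then of_real (w i x) else 0)"

end

theory Submission
  imports Defs "HOL-Real_Asymp.Real_Asymp"
begin

text \<open>
  Suppose \<open>D = V N\<close> is a factorisation, for the direct sum of the classical weights, that produces
  \<open>W\<close>. If \<open>E\<close> is a degree-preserving operator in the algebra of the direct sum such that \<open>D E\<close> is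
  central, then \<open>V (N E)\<close> is a factorisation of a central operator with the same \<open>V\<close>, hence it
  produces the same \<open>W\<close> (\<open>darboux_through_center\<close>). So everything happens in the algebra of the
  direct sum, and the task is to find \<open>E\<close>: a multiple of the inverse of \<open>D\<close>.

  The monic orthogonal polynomials of the direct sum are the diagonal matrices of the scalar ones
  (\<open>monic_ops_direct_sum\<close>), and an operator is determined by its sequence \<open>\<Lambda>\<close> of matrix eigenvalues
  on them. The entry \<open>(a, b)\<close> of \<open>\<Lambda>\<close> belongs to a scalar intertwiner, a differential operator that
  maps the \<open>n\<close>-th orthogonal polynomial of the weight \<open>w a\<close> to a multiple of that of \<open>w b\<close>. Each
  classical sequence consists of eigenfunctions of a second-order operator, with eigenvalues
  \<open>e a n\<close>. Two facts about intertwiners carry the proof.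

  \<^item> After a diagonal conjugation by nonzero numbers \<open>\<kappa> a n\<close>, the entry \<open>(a, b)\<close> is a polynomial in
    \<open>e a n\<close>. For Hermite and Laguerre weights \<open>e a n\<close> is a multiple of \<open>n\<close> and leading coefficients
    show this with \<open>\<kappa> = 1\<close> (\<open>intertwiner_eigenvalue_polynomial\<close>). For Jacobi weights \<open>\<kappa>\<close> is the
    value at the endpoint \<open>1\<close>, where the differential equation expresses all derivatives through
    the value (\<open>derivatives_at_endpoint\<close>).
  \<^item> A nonzero entry forces \<open>e a = e b\<close>. This has content only for Jacobi weights, where
    \<open>e a n = - n (n + s a)\<close>: what an intertwiner does at the endpoint is invariant under the
    reflection \<open>n \<mapsto> - n - s a\<close>, which determines \<open>s a\<close> (\<open>intertwined_eigenfunctions_jacobi\<close>).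

  By the second fact \<open>\<Lambda>\<close> splits into blocks with common eigenvalues. By the first fact and the
  Cayley--Hamilton theorem, each block satisfies a polynomial identity whose coefficients are
  polynomials in the eigenvalues of the block (\<open>block_cayley_hamilton\<close>); its constant coefficient
  is a determinant and does not vanish, because \<open>D\<close> preserves degrees. Dividing the identity by the
  block writes a multiple of the inverse as a polynomial in \<open>D\<close>, constant diagonal matrices and the
  second-order operators, so it comes from a differential operator \<open>E\<close>. The eigenvalues of \<open>D E\<close> are diagonal and scalar on
  every block, and so \<open>D E\<close> is central (\<open>central_multiple_of_operator\<close>).

  The orthogonal polynomials enter through the functional \<open>f \<mapsto> \<integral> f w\<close> alone: it is linear, definite
  on real polynomials, and satisfies the Pearson equation \<open>\<integral> (\<rho> h' + \<tau> h) w = 0\<close>, which makes the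
  operator \<open>\<rho> \<partial>\<^sup>2 + \<tau> \<partial>\<close> symmetric (\<open>orthogonal_eigenfunctions\<close>).
\<close>

section \<open>The Cayley--Hamilton theorem over a commutative ring\<close>

text \<open>
  Powers for the matrix product; the power operation on the type itself is entrywise.
\<close>

primrec mat_power :: "'a::comm_ring_1 ^ 'n::finite ^ 'n \<Rightarrow> nat \<Rightarrow> 'a ^ 'n ^ 'n" where
  "mat_power A 0 = mat 1"
| "mat_power A (Suc k) = mat_power A k ** A"

lemma matrix_mult_nth: "(A ** B) $ i $ j = (\<Sum>k\<in>UNIV. A $ i $ k * B $ k $ j)"
  by (simp add: matrix_matrix_mult_def)

lemma mat_nth: "mat c $ i $ j = (if i = j then c else 0)"
  by (simp add: mat_def)

lemma mat_mult_nth: "((mat c :: 'a::comm_ring_1 ^ 'n::finite ^ 'n) ** A) $ i $ j = c * A $ i $ j"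
  by (simp add: matrix_mult_nth mat_nth if_distrib[of "\<lambda>x. x * _"] cong: if_cong)

lemma mult_mat_nth: "(A ** (mat c :: 'a::comm_ring_1 ^ 'n::finite ^ 'n)) $ i $ j = A $ i $ j * c"
  by (simp add: matrix_mult_nth mat_nth if_distrib[of "\<lambda>x. _ * x"] cong: if_cong)

lemma matrix_mult_zero_left [simp]: "(0 :: 'a::semiring_1 ^ 'n::finite ^ 'm) ** A = 0"
  by (simp add: vec_eq_iff matrix_mult_nth)

lemma matrix_mult_zero_right [simp]: "A ** (0 :: 'a::semiring_1 ^ 'n ^ 'm::finite) = 0"
  by (simp add: vec_eq_iff matrix_mult_nth)

lemma matrix_add_mult: "(A + B) ** (C :: 'a::semiring_1 ^ 'k ^ 'n::finite) = A ** C + B ** C"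
  by (simp add: vec_eq_iff matrix_mult_nth distrib_right sum.distrib)

lemma matrix_diff_mult: "(A - B) ** (C :: 'a::ring_1 ^ 'k ^ 'n::finite) = A ** C - B ** C"
  by (simp add: vec_eq_iff matrix_mult_nth left_diff_distrib sum_subtractf)

lemma matrix_mult_diff: "(C :: 'a::ring_1 ^ 'n::finite ^ 'k) ** (A - B) = C ** A - C ** B"
  by (simp add: vec_eq_iff matrix_mult_nth right_diff_distrib sum_subtractf)

lemma sum_matrix_mult: "(\<Sum>k\<in>S. A k) ** (C :: 'a::comm_ring_1 ^ 'k ^ 'n::finite) = (\<Sum>k\<in>S. A k ** C)"
  by (induction S rule: infinite_finite_induct) (simp_all add: matrix_add_mult)

lemma matrix_mult_sum_right: "(C :: 'a::comm_ring_1 ^ 'n::finite ^ 'k) ** (\<Sum>k\<in>S. A k) = (\<Sum>k\<in>S. C ** A k)"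
  by (induction S rule: infinite_finite_induct) (simp_all add: matrix_add_ldistrib)

text \<open>
  The entry of the adjugate in row \<open>i\<close> and column \<open>j\<close> is the determinant of \<open>M\<close> with row \<open>j\<close>
  replaced by the unit vector \<open>i\<close>. Multiplying by \<open>M\<close> assembles, by multilinearity, the
  determinant of \<open>M\<close> with row \<open>j\<close> replaced by row \<open>l\<close>, which has two equal rows unless \<open>l = j\<close>.
\<close>

lemma adjugate_exists:
  fixes M :: "'a::comm_ring_1 ^ 'n::finite ^ 'n"
  shows "\<exists>B. M ** B = mat (det M)"
proof -
  define B :: "'a ^ 'n ^ 'n" where "B = (\<chi> i j. det (\<chi> r. if r = j then axis i 1 else M $ r))"
  have "(M ** B) $ l $ j = mat (det M) $ l $ j" for l j
  proof -
    have "(M ** B) $ l $ j = (\<Sum>i\<in>UNIV. det (\<chi> r. if r = j then M $ l $ i *s axis i 1 else M $ r))"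
      by (simp add: B_def matrix_mult_nth det_row_mul)
    also have "\<dots> = det (\<chi> r. if r = j then (\<Sum>i\<in>UNIV. M $ l $ i *s axis i 1) else M $ r)"
      by (rule det_linear_row_sum[symmetric]) simp
    also have "(\<Sum>i\<in>UNIV. M $ l $ i *s axis i 1) = M $ l"
      by (rule basis_expansion)
    also have "det (\<chi> r. if r = j then M $ l else M $ r) = mat (det M) $ l $ j"
    proof (cases "l = j")
      case True
      then have "(\<chi> r. if r = j then M $ l else M $ r) = M"
        by (simp add: vec_eq_iff)
      with True show ?thesis by (simp add: mat_nth)
    next
      case False
      then have "det (\<chi> r. if r = j then M $ l else M $ r) = 0"
        by (intro det_identical_rows[OF False]) (simp add: row_def vec_eq_iff)
      with False show ?thesis by (simp add: mat_nth)
    qed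
    finally show ?thesis .
  qed
  then show ?thesis by (auto simp: vec_eq_iff)
qed

definition char_matrix :: "'a::comm_ring_1 ^ 'n::finite ^ 'n \<Rightarrow> 'a poly ^ 'n ^ 'n" where
  "char_matrix A = mat [:0, 1:] - map_matrix (\<lambda>c. [:c:]) A"

text \<open>
  With \<open>B\<close> the adjugate of \<open>X - A\<close>, whose coefficients are \<open>B\<^sub>k\<close>, the coefficients of
  \<open>(X - A) B = det (X - A)\<close> say \<open>B\<^bsub>k-1\<^esub> - A B\<^sub>k = q\<^sub>k\<close>. Multiplying by \<open>A\<^sup>k\<close> and adding up, the
  left-hand sides telescope to \<open>0\<close>.
\<close>

theorem cayley_hamilton:
  fixes A :: "'a::comm_ring_1 ^ 'n::finite ^ 'n"
  defines "q \<equiv> det (char_matrix A)"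
  assumes "degree q < m"
  shows "(\<Sum>k<m. mat (coeff q k) ** mat_power A k) = 0"
proof -
  obtain B where B: "char_matrix A ** B = mat q"
    unfolding q_def using adjugate_exists by blast
  define b where "b k = map_matrix (\<lambda>p. coeff p k) B" for k
  have comm: "mat c ** M = M ** mat c" for c and M :: "'a ^ 'n ^ 'n"
    by (simp add: vec_eq_iff mat_mult_nth mult_mat_nth mult.commute)
  have entry: "[:0, 1:] * B $ i $ j - (\<Sum>l\<in>UNIV. [:A $ i $ l:] * B $ l $ j) = mat q $ i $ j" for i j
    using arg_cong[OF B, of "\<lambda>M. M $ i $ j"]
    by (simp add: char_matrix_def matrix_diff_mult mat_mult_nth) (simp add: matrix_mult_nth)
  have coeff_entry: "coeff ([:0, 1:] * B $ i $ j) k - (\<Sum>l\<in>UNIV. A $ i $ l * coeff (B $ l $ j) k)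
      = coeff (mat q $ i $ j) k" for i j k
    unfolding entry[of i j, symmetric] by (simp add: coeff_sum)
  have zero: "- (A ** b 0) = mat (coeff q 0)"
    using coeff_entry[of _ _ 0] by (simp add: vec_eq_iff b_def matrix_mult_nth mat_nth)
  have step: "b k - A ** b (Suc k) = mat (coeff q (Suc k))" for k
    using coeff_entry[of _ _ "Suc k"] by (simp add: vec_eq_iff b_def matrix_mult_nth mat_nth)
  have partial: "(\<Sum>k<Suc m. mat (coeff q k) ** mat_power A k) = - (mat_power A (Suc m) ** b m)" for m
  proof (induction m)
    case 0
    show ?case using zero by simp
  next
    case (Suc m)
    have "(\<Sum>k<Suc (Suc m). mat (coeff q k) ** mat_power A k) =
        - (mat_power A (Suc m) ** b m) + mat (coeff q (Suc m)) ** mat_power A (Suc m)"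
      by (subst sum.lessThan_Suc) (simp only: Suc)
    also have "mat (coeff q (Suc m)) ** mat_power A (Suc m) =
        mat_power A (Suc m) ** (b m - A ** b (Suc m))"
      unfolding step by (rule comm)
    also have "- (mat_power A (Suc m) ** b m) + \<dots> = - (mat_power A (Suc (Suc m)) ** b (Suc m))"
      by (simp add: matrix_mult_diff matrix_mul_assoc)
    finally show ?case .
  qed
  \<comment> \<open>Far enough out the coefficients of \<open>B\<close> vanish, so the telescoped sum does, too.\<close>
  define M where "M = m + (\<Sum>i\<in>UNIV. \<Sum>j\<in>UNIV. degree (B $ i $ j)) + 1"
  have "b M = 0"
  proof -
    have "degree (B $ i $ j) < M" for i j
    proof -
      have "degree (B $ i $ j) \<le> (\<Sum>j\<in>UNIV. degree (B $ i $ j))"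
        by (rule member_le_sum) auto
      also have "\<dots> \<le> (\<Sum>i\<in>UNIV. \<Sum>j\<in>UNIV. degree (B $ i $ j))"
        by (rule member_le_sum[of i UNIV "\<lambda>i. \<Sum>j\<in>UNIV. degree (B $ i $ j)"]) auto
      finally show ?thesis by (simp add: M_def)
    qed
    then show ?thesis by (simp add: b_def vec_eq_iff coeff_eq_0)
  qed
  have "(\<Sum>k<m. mat (coeff q k) ** mat_power A k) = (\<Sum>k<Suc M. mat (coeff q k) ** mat_power A k)"
  proof (rule sum.mono_neutral_left)
    show "\<forall>k\<in>{..<Suc M} - {..<m}. mat (coeff q k) ** mat_power A k = 0"
      using assms by (auto simp: coeff_eq_0 mat_def vec_eq_iff matrix_mult_nth)
  qed (auto simp: M_def)
  with partial[of M] \<open>b M = 0\<close> show ?thesis by simp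
qed

lemma det_ring_hom:
  fixes h :: "'a::comm_ring_1 \<Rightarrow> 'b::comm_ring_1" and A :: "'a ^ 'n::finite ^ 'n"
  assumes "h 1 = 1" "\<And>x y. h (x + y) = h x + h y" "\<And>x y. h (x * y) = h x * h y"
  shows "det (map_matrix h A) = h (det A)"
proof -
  have zero: "h 0 = 0" using assms(2)[of 0 0] by simp
  have sums: "h (sum f S) = (\<Sum>x\<in>S. h (f x))" for f :: "('n \<Rightarrow> 'n) \<Rightarrow> 'a" and S
    by (induction S rule: infinite_finite_induct) (simp_all add: assms zero)
  have prods: "h (prod f S) = (\<Prod>x\<in>S. h (f x))" for f :: "'n \<Rightarrow> 'a" and S
    by (induction S rule: infinite_finite_induct) (simp_all add: assms zero)
  have neg: "h (- x) = - h x" for x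
    using assms(2)[of x "- x"] zero by (simp add: eq_neg_iff_add_eq_0 add.commute)
  have "h (of_int (sign p)) = of_int (sign p)" for p :: "'n \<Rightarrow> 'n"
    by (simp add: sign_def neg assms)
  then show ?thesis
    by (simp add: det_def sums assms prods)
qed

lemma map_matrix_mult_hom:
  fixes h :: "'a::comm_ring_1 \<Rightarrow> 'b::comm_ring_1" and A :: "'a ^ 'm::finite ^ 'k"
  assumes "h 0 = 0" "\<And>x y. h (x + y) = h x + h y" "\<And>x y. h (x * y) = h x * h y"
  shows "map_matrix h (A ** B) = map_matrix h A ** map_matrix h B"
proof -
  have "h (sum f S) = (\<Sum>x\<in>S. h (f x))" for f :: "'m \<Rightarrow> 'a" and S
    by (induction S rule: infinite_finite_induct) (simp_all add: assms)
  then show ?thesis by (simp add: vec_eq_iff matrix_mult_nth assms)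
qed

text \<open>
  Cayley--Hamilton over the ring of polynomials in \<open>t\<close>, evaluated at each \<open>t\<close>, so that the
  coefficients of the relation depend polynomially on \<open>t\<close>.
\<close>

lemma polynomial_cayley_hamilton:
  fixes a :: "complex poly ^ 'n::finite ^ 'n"
  defines "A \<equiv> \<lambda>t. map_matrix (\<lambda>p. poly p t) a"
  shows "\<exists>(m::nat) c. \<forall>t. (\<Sum>k<Suc m. mat (poly (c k) t) ** mat_power (A t) k) = 0 \<and>
    poly (c 0) t = det (- A t)"
proof (intro exI allI conjI)
  let ?q = "det (char_matrix a)"
  have pow: "map_matrix (\<lambda>p. poly p t) (mat_power a k) = mat_power (A t) k" for t k
  proof (induction k)
    case 0
    show ?case by (simp add: vec_eq_iff mat_nth)
  next
    case (Suc k)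
    then show ?case by (simp add: map_matrix_mult_hom) (simp add: A_def)
  qed
  fix t
  have "0 = map_matrix (\<lambda>p. poly p t) (\<Sum>k<Suc (degree ?q). mat (coeff ?q k) ** mat_power a k)"
    by (subst cayley_hamilton) (simp_all add: vec_eq_iff)
  also have "\<dots> = (\<Sum>k<Suc (degree ?q). map_matrix (\<lambda>p. poly p t) (mat (coeff ?q k) ** mat_power a k))"
    by (simp add: vec_eq_iff poly_sum)
  also have "\<dots> = (\<Sum>k<Suc (degree ?q). mat (poly (coeff ?q k) t) ** mat_power (A t) k)"
    by (rule sum.cong) (simp_all add: vec_eq_iff mat_mult_nth pow[symmetric])
  finally show "(\<Sum>k<Suc (degree ?q). mat (poly (coeff ?q k) t) ** mat_power (A t) k) = 0" by simp
  have "coeff ?q 0 = det (map_matrix (\<lambda>q. coeff q 0) (char_matrix a))"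
    by (rule det_ring_hom[symmetric]) (simp_all add: coeff_mult_0)
  then have "poly (coeff ?q 0) t = poly (det (map_matrix (\<lambda>q. coeff q 0) (char_matrix a))) t"
    by simp
  also have "\<dots> = det (map_matrix (\<lambda>p. poly p t) (map_matrix (\<lambda>q. coeff q 0) (char_matrix a)))"
    by (rule det_ring_hom[symmetric]) simp_all
  also have "map_matrix (\<lambda>p. poly p t) (map_matrix (\<lambda>q. coeff q 0) (char_matrix a)) = - A t"
    by (simp add: vec_eq_iff char_matrix_def A_def mat_nth)
  finally show "poly (coeff ?q 0) t = det (- A t)" .
qed

section \<open>Matrix differential operators and their eigenvalues\<close>

lemma mpoly_coeff_nth [simp]: "mpoly_coeff P k $ i $ j = coeff (P $ i $ j) k"
  by (simp add: mpoly_coeff_def)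

lemma const_mpoly_mult_nth: "(const_mpoly A ** P) $ i $ j = (\<Sum>k\<in>UNIV. smult (A $ i $ k) (P $ k $ j))"
  by (simp add: matrix_mult_nth const_mpoly_def)

lemma mpoly_coeff_const_mult [simp]: "mpoly_coeff (const_mpoly A ** P) k = A ** mpoly_coeff P k"
  by (simp add: vec_eq_iff const_mpoly_mult_nth coeff_sum) (simp add: matrix_mult_nth)

lemma mpoly_coeff_add [simp]: "mpoly_coeff (P + Q) k = mpoly_coeff P k + mpoly_coeff Q k"
  by (simp add: vec_eq_iff)

lemma mpoly_coeff_diff [simp]: "mpoly_coeff (P - Q) k = mpoly_coeff P k - mpoly_coeff Q k"
  by (simp add: vec_eq_iff)

lemma mpoly_coeff_0 [simp]: "mpoly_coeff 0 k = 0"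
  by (simp add: vec_eq_iff)

lemma mpoly_eq_iff: "P = Q \<longleftrightarrow> (\<forall>k. mpoly_coeff P k = mpoly_coeff Q k)"
  by (auto simp: vec_eq_iff poly_eq_iff)

lemma const_mpoly_mult: "const_mpoly (A ** B) = const_mpoly A ** const_mpoly B"
proof -
  have "[:\<Sum>k\<in>UNIV. A $ i $ k * B $ k $ j:] = (\<Sum>k\<in>UNIV. [:A $ i $ k:] * [:B $ k $ j:])" for i j
    by (intro poly_eqI) (simp add: coeff_sum coeff_pCons mult.commute split: nat.split)
  then show ?thesis
    by (simp add: vec_eq_iff matrix_mult_nth const_mpoly_def)
qed

lemma const_mpoly_add: "const_mpoly (A + B) = const_mpoly A + const_mpoly B"
  by (simp add: vec_eq_iff const_mpoly_def)

lemma mpoly_degree_ge: "degree (P $ i $ j) \<le> mpoly_degree P"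
proof -
  have "{degree (P $ i $ j) | i j. True} = (\<lambda>(i, j). degree (P $ i $ j)) ` UNIV"
    by auto
  then have "finite {degree (P $ i $ j) | i j. True}"
    by simp
  then show ?thesis
    unfolding mpoly_degree_def by (rule Max_ge) blast
qed

lemma mpoly_degree_attained: "\<exists>i j. degree (P $ i $ j) = mpoly_degree P"
proof -
  have "{degree (P $ i $ j) | i j. True} = (\<lambda>(i, j). degree (P $ i $ j)) ` UNIV"
    by auto
  then have "finite {degree (P $ i $ j) | i j. True}" "{degree (P $ i $ j) | i j. True} \<noteq> {}"
    by auto
  from Max_in[OF this] have "mpoly_degree P \<in> {degree (P $ i $ j) | i j. True}"
    unfolding mpoly_degree_def .
  then show ?thesis by force
qed

lemma mpoly_coeff_eq_0: "mpoly_degree P < k \<Longrightarrow> mpoly_coeff P k = 0"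
  by (simp add: vec_eq_iff coeff_eq_0 le_less_trans[OF mpoly_degree_ge])

lemma mpoly_degree_eqI:
  assumes "mpoly_coeff P d \<noteq> 0" and "\<And>k. d < k \<Longrightarrow> mpoly_coeff P k = 0"
  shows "mpoly_degree P = d"
proof (rule antisym)
  obtain i j where ij: "degree (P $ i $ j) = mpoly_degree P"
    using mpoly_degree_attained by blast
  have "coeff (P $ i $ j) k = 0" if "d < k" for k
    using assms(2)[OF that] by (simp add: vec_eq_iff)
  then have "degree (P $ i $ j) \<le> d"
    by (intro degree_le) blast
  then show "mpoly_degree P \<le> d"
    by (simp only: ij)
  show "d \<le> mpoly_degree P"
    using assms(1) mpoly_coeff_eq_0[of P d] by (meson not_le)
qed

lemma mpoly_coeff_degree_nonzero:
  assumes "P \<noteq> 0"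
  shows "mpoly_coeff P (mpoly_degree P) \<noteq> 0"
proof
  assume zero: "mpoly_coeff P (mpoly_degree P) = 0"
  obtain i j where ij: "degree (P $ i $ j) = mpoly_degree P"
    using mpoly_degree_attained by blast
  have "coeff (P $ i $ j) (mpoly_degree P) = 0"
    using zero by (metis mpoly_coeff_nth zero_index)
  then have "P $ i $ j = 0"
    using ij by (metis leading_coeff_0_iff)
  then have "mpoly_degree P = 0"
    using ij by (metis degree_0)
  then have "mpoly_coeff P k = 0" for k
    using zero mpoly_coeff_eq_0[of P k] by (cases k) auto
  with assms show False by (simp add: mpoly_eq_iff)
qed

text \<open>A sequence with leading coefficients \<open>I\<close> is a basis of the left module of matrix polynomials.\<close>

definition monic_sequence :: "(nat \<Rightarrow> 'n::finite mpoly) \<Rightarrow> bool" where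
  "monic_sequence P \<longleftrightarrow> (\<forall>n. mpoly_coeff (P n) n = mat 1 \<and> (\<forall>k>n. mpoly_coeff (P n) k = 0))"

text \<open>
  Subtracting \<open>C ** P n\<close>, with \<open>C\<close> the coefficient of \<open>x\<^sup>n\<close>, lowers the degree; iterating this
  expands any polynomial.
\<close>

lemma monic_sequence_induct [consumes 1, case_names zero add]:
  assumes "monic_sequence P"
    and "pr 0" and "\<And>Q C n. pr Q \<Longrightarrow> pr (Q + const_mpoly C ** P n)"
  shows "pr Q"
proof -
  have "\<forall>Q :: 'a mpoly. (\<forall>k\<ge>n. mpoly_coeff Q k = 0) \<longrightarrow> pr Q" for n
  proof (induction n)
    case 0
    have "Q = 0" if "\<forall>k\<ge>0. mpoly_coeff Q k = 0" for Q :: "'a mpoly"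
      using that by (simp add: mpoly_eq_iff)
    then show ?case using assms(2) by blast
  next
    case (Suc n)
    show ?case
    proof (intro allI impI)
      fix Q :: "'a mpoly" assume Q: "\<forall>k\<ge>Suc n. mpoly_coeff Q k = 0"
      let ?R = "Q - const_mpoly (mpoly_coeff Q n) ** P n"
      have "mpoly_coeff ?R k = 0" if "k \<ge> n" for k
        using Q that assms(1) by (cases "k = n") (auto simp: monic_sequence_def)
      then have "pr ?R" using Suc by blast
      from assms(3)[OF this, of "mpoly_coeff Q n" n] show "pr Q" by simp
    qed
  qed
  moreover have "\<forall>k\<ge>Suc (mpoly_degree Q). mpoly_coeff Q k = 0"
    by (simp add: mpoly_coeff_eq_0)
  ultimately show ?thesis by blast
qed

subsection \<open>Closure properties of differential operators\<close>

lemma diff_ops_term: "(\<lambda>P :: 'n::finite mpoly. map_matrix (pderiv ^^ j) P ** F) \<in> diff_ops"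
proof -
  have "map_matrix (pderiv ^^ j) P ** F =
      (\<Sum>i\<le>j. map_matrix (pderiv ^^ i) P ** (if i = j then F else 0))" for P :: "'n mpoly"
    by (simp add: if_distrib[of "\<lambda>G. _ ** G"] sum.delta cong: if_cong)
  then show ?thesis unfolding diff_ops_def by (auto intro!: exI[of _ j] exI[of _ "\<lambda>i. if i = j then F else 0"])
qed

lemma diff_ops_add:
  fixes D E :: "'n::finite mdiffop"
  assumes "D \<in> diff_ops" "E \<in> diff_ops"
  shows "(\<lambda>P. D P + E P) \<in> diff_ops"
proof -
  from assms obtain m F k G where
    D: "\<And>P. D P = (\<Sum>j\<le>m. map_matrix (pderiv ^^ j) P ** F j)" and
    E: "\<And>P. E P = (\<Sum>j\<le>k. map_matrix (pderiv ^^ j) P ** G j)"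
    unfolding diff_ops_def by auto
  let ?H = "\<lambda>j. (if j \<le> m then F j else 0) + (if j \<le> k then G j else 0)"
  have "D P + E P = (\<Sum>j\<le>max m k. map_matrix (pderiv ^^ j) P ** ?H j)" for P
  proof -
    have 1: "(\<Sum>j\<le>max m k. map_matrix (pderiv ^^ j) P ** (if j \<le> m then F j else 0)) = D P"
      unfolding D by (rule sum.mono_neutral_cong_right) auto
    have 2: "(\<Sum>j\<le>max m k. map_matrix (pderiv ^^ j) P ** (if j \<le> k then G j else 0)) = E P"
      unfolding E by (rule sum.mono_neutral_cong_right) auto
    show ?thesis by (simp only: matrix_add_ldistrib sum.distrib 1 2)
  qed
  then show ?thesis unfolding diff_ops_def by (intro CollectI exI allI)
qed

lemma diff_ops_zero: "(\<lambda>P. 0) \<in> diff_ops"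
  using diff_ops_term[of 0 0] by simp

lemma diff_ops_sum:
  assumes "\<And>j. j \<in> S \<Longrightarrow> D j \<in> diff_ops"
  shows "(\<lambda>P. \<Sum>j\<in>S. D j P) \<in> diff_ops"
  using assms
  by (induction S rule: infinite_finite_induct) (simp_all add: diff_ops_zero diff_ops_add)

lemma diff_ops_mult_right:
  fixes D :: "'n::finite mdiffop"
  assumes "D \<in> diff_ops"
  shows "(\<lambda>P. D P ** F) \<in> diff_ops"
proof -
  from assms obtain m G where
    D: "\<And>P. D P = (\<Sum>j\<le>m. map_matrix (pderiv ^^ j) P ** G j)"
    unfolding diff_ops_def by auto
  have "D P ** F = (\<Sum>j\<le>m. map_matrix (pderiv ^^ j) P ** (G j ** F))" for P
    by (simp add: D sum_matrix_mult matrix_mul_assoc)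
  then show ?thesis unfolding diff_ops_def by (intro CollectI exI allI)
qed

lemma pderiv_sum: "pderiv (sum f S) = (\<Sum>x\<in>S. pderiv (f x))"
  using higher_pderiv_sum[of 1 f S] by simp

lemma map_matrix_pderiv_mult:
  "map_matrix pderiv (P ** Q) = map_matrix pderiv P ** Q + P ** map_matrix pderiv Q"
  by (simp add: vec_eq_iff matrix_mult_nth pderiv_sum pderiv_mult sum.distrib algebra_simps)

text \<open>
  Differentiating \<open>\<partial>\<^sup>j F\<close> by the product rule gives two terms of the same shape. With right
  multiplication this generates composition.
\<close>

lemma diff_ops_pderiv:
  fixes D :: "'n::finite mdiffop"
  assumes "D \<in> diff_ops"
  shows "(\<lambda>P. map_matrix pderiv (D P)) \<in> diff_ops"
proof -
  from assms obtain m F where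
    D: "\<And>P. D P = (\<Sum>j\<le>m. map_matrix (pderiv ^^ j) P ** F j)"
    unfolding diff_ops_def by auto
  have distr: "map_matrix pderiv (\<Sum>j\<in>S. G j) = (\<Sum>j\<in>S. map_matrix pderiv (G j))" for S and G :: "nat \<Rightarrow> 'n mpoly"
    by (simp add: vec_eq_iff pderiv_sum)
  have iter: "map_matrix pderiv (map_matrix (pderiv ^^ j) P) = map_matrix (pderiv ^^ Suc j) P"
    for j and P :: "'n mpoly"
    by (simp add: vec_eq_iff)
  have "(\<lambda>P. map_matrix pderiv (D P)) = (\<lambda>P. \<Sum>j\<le>m. map_matrix (pderiv ^^ Suc j) P ** F j +
      map_matrix (pderiv ^^ j) P ** map_matrix pderiv (F j))"
    by (simp only: D distr map_matrix_pderiv_mult iter)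
  then show ?thesis
    by (simp only:) (intro diff_ops_sum diff_ops_add diff_ops_term)
qed

lemma op_prod_diff_ops:
  fixes D E :: "'n::finite mdiffop"
  assumes "D \<in> diff_ops" "E \<in> diff_ops"
  shows "op_prod D E \<in> diff_ops"
proof -
  from assms(2) obtain m F where
    E: "\<And>P. E P = (\<Sum>j\<le>m. map_matrix (pderiv ^^ j) P ** F j)"
    unfolding diff_ops_def by auto
  have "(\<lambda>P. map_matrix (pderiv ^^ j) (D P)) \<in> diff_ops" for j
  proof (induction j)
    case 0
    then show ?case using assms(1) by (simp add: map_matrix_def)
  next
    case (Suc j)
    have "(\<lambda>P. map_matrix (pderiv ^^ Suc j) (D P)) = (\<lambda>P. map_matrix pderiv (map_matrix (pderiv ^^ j) (D P)))"
      by (simp add: vec_eq_iff fun_eq_iff)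
    with diff_ops_pderiv[OF Suc] show ?case by (simp only:)
  qed
  then have "(\<lambda>P. \<Sum>j\<le>m. map_matrix (pderiv ^^ j) (D P) ** F j) \<in> diff_ops"
    by (intro diff_ops_sum diff_ops_mult_right)
  then show ?thesis by (simp add: op_prod_def E)
qed

text \<open>The coefficients of an operator stand on the right, so it is linear over matrices on the left.\<close>

lemma diff_ops_left_linear:
  fixes D :: "'n::finite mdiffop"
  assumes "D \<in> diff_ops"
  shows "D (P + Q) = D P + D Q" and "D (const_mpoly A ** P) = const_mpoly A ** D P" and "D 0 = 0"
proof -
  from assms obtain m F where
    D: "\<And>P. D P = (\<Sum>j\<le>m. map_matrix (pderiv ^^ j) P ** F j)"
    unfolding diff_ops_def by auto
  have add: "map_matrix (pderiv ^^ j) (P + Q) = map_matrix (pderiv ^^ j) P + map_matrix (pderiv ^^ j) Q" for j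
    by (simp add: vec_eq_iff higher_pderiv_add)
  have scale: "map_matrix (pderiv ^^ j) (const_mpoly A ** P) = const_mpoly A ** map_matrix (pderiv ^^ j) P" for j
    by (simp add: vec_eq_iff const_mpoly_mult_nth higher_pderiv_sum higher_pderiv_smult)
  show "D (P + Q) = D P + D Q"
    by (simp add: D add matrix_add_mult sum.distrib)
  show "D (const_mpoly A ** P) = const_mpoly A ** D P"
    by (simp add: D scale matrix_mult_sum_right matrix_mul_assoc)
  have "map_matrix (pderiv ^^ j) 0 = (0 :: 'n mpoly)" for j
    by (simp add: vec_eq_iff)
  then show "D 0 = 0" by (simp add: D)
qed

subsection \<open>Operators that are diagonal in a monic sequence\<close>

definition has_eigenvalues :: "(nat \<Rightarrow> 'n::finite mpoly) \<Rightarrow> 'n mdiffop \<Rightarrow> (nat \<Rightarrow> 'n cmat) \<Rightarrow> bool" where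
  "has_eigenvalues P D \<Lambda> \<longleftrightarrow> D \<in> diff_ops \<and> (\<forall>n. D (P n) = const_mpoly (\<Lambda> n) ** P n)"

lemma has_eigenvalues_op_prod:
  assumes "has_eigenvalues P D \<Lambda>" "has_eigenvalues P E \<Gamma>"
  shows "has_eigenvalues P (op_prod D E) (\<lambda>n. \<Lambda> n ** \<Gamma> n)"
  using assms
  by (auto simp: has_eigenvalues_def op_prod_diff_ops diff_ops_left_linear const_mpoly_mult matrix_mul_assoc)
     (simp add: op_prod_def diff_ops_left_linear matrix_mul_assoc)

text \<open>
  An operator is determined by its eigenvalues, so identities of operators can be checked on
  eigenvalues.
\<close>

lemma has_eigenvalues_unique_op:
  assumes "monic_sequence P" "has_eigenvalues P D \<Lambda>" "has_eigenvalues P E \<Lambda>"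
  shows "D = E"
proof
  fix Q
  from assms(1) show "D Q = E Q"
    using assms(2,3)
    by (induction Q rule: monic_sequence_induct) (simp_all add: has_eigenvalues_def diff_ops_left_linear)
qed

text \<open>
  Modulo lower degrees \<open>Q\<close> is its leading coefficient times \<open>P d\<close>, on which the operator multiplies
  by \<open>\<Lambda> d\<close>; lower degrees stay lower, by induction along the same reduction.
\<close>

lemma has_eigenvalues_leading_coeff:
  assumes P: "monic_sequence P" and D: "has_eigenvalues P D \<Lambda>"
    and Q: "\<And>k. k > d \<Longrightarrow> mpoly_coeff Q k = 0"
  shows "mpoly_coeff (D Q) d = mpoly_coeff Q d ** \<Lambda> d"
    and "\<And>k. k > d \<Longrightarrow> mpoly_coeff (D Q) k = 0"
proof -
  let ?red = "\<lambda>Q n. Q - const_mpoly (mpoly_coeff Q n) ** P n"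
  have red: "mpoly_coeff (?red Q n) k = 0" if "\<forall>k\<ge>Suc n. mpoly_coeff Q k = 0" "k \<ge> n" for Q n k
    using that P by (cases "k = n") (auto simp: monic_sequence_def)
  have split: "D Q = D (?red Q n) + const_mpoly (mpoly_coeff Q n ** \<Lambda> n) ** P n" for Q n
  proof -
    have "D (?red Q n + const_mpoly (mpoly_coeff Q n) ** P n) =
        D (?red Q n) + const_mpoly (mpoly_coeff Q n ** \<Lambda> n) ** P n"
      using D by (simp only: has_eigenvalues_def diff_ops_left_linear const_mpoly_mult matrix_mul_assoc)
    then show ?thesis by simp
  qed
  have bound: "\<forall>Q. (\<forall>k\<ge>n. mpoly_coeff Q k = 0) \<longrightarrow> (\<forall>k\<ge>n. mpoly_coeff (D Q) k = 0)" for n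
  proof (induction n)
    case 0
    have "D 0 = 0" using D by (simp add: has_eigenvalues_def diff_ops_left_linear)
    then show ?case by (auto simp: mpoly_eq_iff[of _ 0, simplified, symmetric])
  next
    case (Suc n)
    show ?case
    proof (intro allI impI)
      fix Q :: "'a mpoly" and k
      assume "\<forall>k\<ge>Suc n. mpoly_coeff Q k = 0" and k: "k \<ge> Suc n"
      with red have "\<forall>k\<ge>n. mpoly_coeff (?red Q n) k = 0" by blast
      with Suc have "mpoly_coeff (D (?red Q n)) k = 0" using k Suc_leD by blast
      with k P show "mpoly_coeff (D Q) k = 0"
        by (subst split[of Q n]) (auto simp: monic_sequence_def)
    qed
  qed
  have high: "\<forall>k\<ge>Suc d. mpoly_coeff Q k = 0"
    using Q by (simp add: Suc_le_eq)
  then have low: "\<forall>k\<ge>d. mpoly_coeff (?red Q d) k = 0"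
    using red by blast
  have "mpoly_coeff (D (?red Q d)) d = 0"
    using bound low by blast
  with P show "mpoly_coeff (D Q) d = mpoly_coeff Q d ** \<Lambda> d"
    by (subst split[of Q d]) (auto simp: monic_sequence_def)
  fix k assume "k > d"
  with bound[of "Suc d"] high show "mpoly_coeff (D Q) k = 0"
    using Suc_leI by blast
qed

lemma invertible_mult_eq_0_iff:
  fixes A :: "complex ^ 'n::finite ^ 'n"
  assumes "invertible A"
  shows "C ** A = 0 \<longleftrightarrow> C = 0"
proof
  assume CA: "C ** A = 0"
  from assms obtain B where B: "A ** B = mat 1"
    unfolding invertible_def by blast
  have "C = C ** (A ** B)" by (simp add: B)
  also have "\<dots> = 0" by (simp add: matrix_mul_assoc CA)
  finally show "C = 0" .
qed simp

text \<open>
  A vector in the kernel of the transpose, repeated in every row, is a matrix that \<open>A\<close> annihilates.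
\<close>

lemma invertible_if_left_kernel_trivial:
  fixes A :: "complex ^ 'n::finite ^ 'n"
  assumes "\<And>C :: complex ^ 'n ^ 'n. C ** A = 0 \<Longrightarrow> C = 0"
  shows "invertible A"
proof (rule ccontr)
  assume "\<not> invertible A"
  then have "\<not> invertible (transpose A)" by (simp add: invertible_det_nz)
  then obtain x where x: "transpose A *v x = 0" "x \<noteq> 0"
    by (metis invertible_left_inverse matrix_left_invertible_ker)
  define C :: "complex ^ 'n ^ 'n" where "C = (\<chi> i. x)"
  have "(C ** A) $ i $ j = (x v* A) $ j" for i j
    by (simp add: C_def matrix_mult_nth vector_matrix_mult_def mult.commute)
  with x(1) have "C ** A = 0" by (simp add: vec_eq_iff)
  then have "C = 0" by (rule assms)
  with x(2) show False by (simp add: C_def vec_eq_iff)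
qed

text \<open>
  On leading coefficients of degree \<open>d\<close> the operator is right multiplication by \<open>\<Lambda> d\<close>.
\<close>

lemma degree_preserving_iff_eigenvalues_invertible:
  assumes P: "monic_sequence P" and D: "has_eigenvalues P D \<Lambda>"
  shows "degree_preserving D \<longleftrightarrow> (\<forall>n. invertible (\<Lambda> n))"
proof
  assume inv: "\<forall>n. invertible (\<Lambda> n)"
  show "degree_preserving D"
    unfolding degree_preserving_def
  proof (intro conjI allI impI)
    show "D \<in> diff_ops" using D by (simp add: has_eigenvalues_def)
    fix Q :: "'a mpoly" assume "Q \<noteq> 0"
    let ?d = "mpoly_degree Q"
    have "mpoly_coeff (D Q) ?d = mpoly_coeff Q ?d ** \<Lambda> ?d"
      by (rule has_eigenvalues_leading_coeff[OF P D]) (rule mpoly_coeff_eq_0)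
    then have nz: "mpoly_coeff (D Q) ?d \<noteq> 0"
      using inv mpoly_coeff_degree_nonzero[OF \<open>Q \<noteq> 0\<close>] by (simp add: invertible_mult_eq_0_iff)
    then show "D Q \<noteq> 0" by auto
    show "mpoly_degree (D Q) = ?d"
      using nz by (rule mpoly_degree_eqI) (rule has_eigenvalues_leading_coeff[OF P D], auto intro: mpoly_coeff_eq_0)
  qed
next
  assume dp: "degree_preserving D"
  show "\<forall>n. invertible (\<Lambda> n)"
  proof (intro allI invertible_if_left_kernel_trivial)
    fix n and C :: "'a cmat" assume "C ** \<Lambda> n = 0"
    then have "D (const_mpoly C ** P n) = const_mpoly 0 ** P n"
      using D by (simp add: has_eigenvalues_def diff_ops_left_linear matrix_mul_assoc const_mpoly_mult[symmetric])
    also have "\<dots> = 0" by (simp add: mpoly_eq_iff)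
    finally have "const_mpoly C ** P n = 0"
      using dp unfolding degree_preserving_def by blast
    then have "mpoly_coeff (const_mpoly C ** P n) n = 0" by simp
    with P show "C = 0" by (simp add: monic_sequence_def)
  qed
qed

lemma degree_preserving_op_prod:
  assumes "degree_preserving D" "degree_preserving E"
  shows "degree_preserving (op_prod D E)"
  using assms by (simp add: degree_preserving_def op_prod_diff_ops) (simp add: op_prod_def)

section \<open>Diagonal sequences and a central multiple of an operator\<close>

definition scalar_diff_ops :: "(complex poly \<Rightarrow> complex poly) set" where
  "scalar_diff_ops = {T. \<exists>(m::nat) f. \<forall>q. T q = (\<Sum>j\<le>m. (pderiv ^^ j) q * f j)}"

definition diag_sequence :: "('n::finite \<Rightarrow> nat \<Rightarrow> complex poly) \<Rightarrow> nat \<Rightarrow> 'n mpoly" where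
  "diag_sequence p n = (\<chi> i j. if i = j then p i n else 0)"

definition diag_mat :: "('n::finite \<Rightarrow> complex) \<Rightarrow> 'n cmat" where
  "diag_mat c = (\<chi> i j. if i = j then c i else 0)"

lemma diag_mat_mult_nth: "(diag_mat c ** A) $ i $ j = c i * A $ i $ j"
  by (simp add: diag_mat_def matrix_mult_nth if_distrib[of "\<lambda>x. x * _"] cong: if_cong)

lemma mult_diag_mat_nth: "(A ** diag_mat c) $ i $ j = A $ i $ j * c j"
  by (simp add: diag_mat_def matrix_mult_nth if_distrib[of "\<lambda>x. _ * x"] cong: if_cong)

lemma diag_mat_nth: "diag_mat c $ i $ j = (if i = j then c i else 0)"
  by (simp add: diag_mat_def)

lemma diag_sequence_mult_nth: "(diag_sequence p n ** A) $ i $ j = p i n * A $ i $ j"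
  by (simp add: diag_sequence_def matrix_mult_nth if_distrib[of "\<lambda>x. x * _"] cong: if_cong)

lemma mult_diag_sequence_nth: "(A ** diag_sequence p n) $ i $ j = A $ i $ j * p j n"
  by (simp add: diag_sequence_def matrix_mult_nth if_distrib[of "\<lambda>x. _ * x"] cong: if_cong)

lemma monic_sequence_diag_sequence:
  assumes "\<And>i n. degree (p i n) = n" "\<And>i n. coeff (p i n) n = 1"
  shows "monic_sequence (diag_sequence p)"
proof -
  have "coeff (p i n) k = 0" if "k > n" for i n k
    using assms(1) that by (simp add: coeff_eq_0)
  then show ?thesis
    using assms by (simp add: monic_sequence_def vec_eq_iff diag_sequence_def mat_nth)
qed

lemma diff_op_entries:
  assumes "D \<in> diff_ops"
  shows "\<exists>T. (\<forall>a b. T a b \<in> scalar_diff_ops) \<and> (\<forall>P i b. D P $ i $ b = (\<Sum>a\<in>UNIV. T a b (P $ i $ a)))"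
proof -
  from assms obtain m F where
    D: "\<And>P. D P = (\<Sum>j\<le>m. map_matrix (pderiv ^^ j) P ** F j)"
    unfolding diff_ops_def by auto
  define T where "T a b q = (\<Sum>j\<le>m. (pderiv ^^ j) q * F j $ a $ b)" for a b q
  show ?thesis
  proof (intro exI conjI allI)
    show "T a b \<in> scalar_diff_ops" for a b
      unfolding scalar_diff_ops_def mem_Collect_eq
      by (rule exI[of _ m], rule exI[of _ "\<lambda>j. F j $ a $ b"]) (simp add: T_def)
    show "D P $ i $ b = (\<Sum>a\<in>UNIV. T a b (P $ i $ a))" for P i b
      unfolding D T_def by (subst sum.swap) (simp add: matrix_mult_nth)
  qed
qed

text \<open>
  An operator with matrix eigenvalues on a diagonal sequence is a matrix of scalar intertwiners:
  its entry \<open>(a, b)\<close> sends each member of the \<open>a\<close>-th scalar sequence to a multiple of the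
  corresponding member of the \<open>b\<close>-th one.
\<close>

definition intertwiner :: "(nat \<Rightarrow> complex poly) \<Rightarrow> (nat \<Rightarrow> complex poly) \<Rightarrow> (nat \<Rightarrow> complex) \<Rightarrow> bool" where
  "intertwiner p q \<mu> \<longleftrightarrow> (\<exists>T\<in>scalar_diff_ops. \<forall>n. T (p n) = smult (\<mu> n) (q n))"

lemma has_eigenvalues_entry_intertwiner:
  assumes "has_eigenvalues (diag_sequence p) D \<Lambda>"
  shows "intertwiner (p a) (p b) (\<lambda>n. \<Lambda> n $ a $ b)"
proof -
  have "D \<in> diff_ops" using assms by (simp add: has_eigenvalues_def)
  from diff_op_entries[OF this] obtain T where T: "\<And>a b. T a b \<in> scalar_diff_ops"
    and D: "\<And>P i b. D P $ i $ b = (\<Sum>a\<in>UNIV. T a b (P $ i $ a))"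
    by blast
  have zero: "T c b 0 = 0" for c
    using T[of c b] by (auto simp: scalar_diff_ops_def)
  have "T a b (p a n) = smult (\<Lambda> n $ a $ b) (p b n)" for n
  proof -
    have "T a b (p a n) = (\<Sum>c\<in>UNIV. if c = a then T a b (p a n) else 0)"
      by simp
    also have "\<dots> = D (diag_sequence p n) $ a $ b"
      unfolding D by (rule sum.cong) (auto simp: diag_sequence_def zero)
    also have "\<dots> = (const_mpoly (\<Lambda> n) ** diag_sequence p n) $ a $ b"
      using assms by (simp add: has_eigenvalues_def)
    finally show ?thesis
      by (simp add: mult_diag_sequence_nth) (simp add: const_mpoly_def)
  qed
  with T show ?thesis unfolding intertwiner_def by blast
qed

text \<open>
  The eigenvalue sequences that come from differential operators. The operator sought below is
  constructed as an element of this algebra.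
\<close>

definition eigenvalue_algebra :: "(nat \<Rightarrow> 'n::finite mpoly) \<Rightarrow> (nat \<Rightarrow> 'n cmat) set" where
  "eigenvalue_algebra P = {\<Lambda>. \<exists>D. has_eigenvalues P D \<Lambda>}"

lemma eigenvalue_algebra_mult:
  "\<Lambda> \<in> eigenvalue_algebra P \<Longrightarrow> \<Gamma> \<in> eigenvalue_algebra P \<Longrightarrow> (\<lambda>n. \<Lambda> n ** \<Gamma> n) \<in> eigenvalue_algebra P"
  unfolding eigenvalue_algebra_def by (blast intro: has_eigenvalues_op_prod)

lemma eigenvalue_algebra_add:
  assumes "\<Lambda> \<in> eigenvalue_algebra P" "\<Gamma> \<in> eigenvalue_algebra P"
  shows "(\<lambda>n. \<Lambda> n + \<Gamma> n) \<in> eigenvalue_algebra P"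
proof -
  from assms obtain D E where "has_eigenvalues P D \<Lambda>" "has_eigenvalues P E \<Gamma>"
    unfolding eigenvalue_algebra_def by blast
  then have "has_eigenvalues P (\<lambda>Q. D Q + E Q) (\<lambda>n. \<Lambda> n + \<Gamma> n)"
    by (simp add: has_eigenvalues_def diff_ops_add const_mpoly_add matrix_add_mult)
  then show ?thesis unfolding eigenvalue_algebra_def by blast
qed

lemma eigenvalue_algebra_zero: "(\<lambda>n. 0) \<in> eigenvalue_algebra P"
proof -
  have "has_eigenvalues P (\<lambda>Q. 0) (\<lambda>n. 0)"
    by (simp add: has_eigenvalues_def diff_ops_zero mpoly_eq_iff)
  then show ?thesis unfolding eigenvalue_algebra_def by blast
qed

lemma eigenvalue_algebra_sum:
  assumes "\<And>j. j \<in> S \<Longrightarrow> \<Lambda> j \<in> eigenvalue_algebra P"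
  shows "(\<lambda>n. \<Sum>j\<in>S. \<Lambda> j n) \<in> eigenvalue_algebra P"
  using assms
  by (induction S rule: infinite_finite_induct) (simp_all add: eigenvalue_algebra_zero eigenvalue_algebra_add)

lemma eigenvalue_algebra_diag: "(\<lambda>n. diag_mat c) \<in> eigenvalue_algebra (diag_sequence p)"
proof -
  have "(\<lambda>Q. map_matrix (pderiv ^^ 0) Q ** const_mpoly (diag_mat c)) \<in> diff_ops"
    by (rule diff_ops_term)
  then have "(\<lambda>Q. Q ** const_mpoly (diag_mat c)) \<in> diff_ops"
    by (simp add: map_matrix_def)
  moreover have "diag_sequence p n ** const_mpoly (diag_mat c) = const_mpoly (diag_mat c) ** diag_sequence p n" for n
    by (simp add: vec_eq_iff diag_sequence_mult_nth mult_diag_sequence_nth const_mpoly_def diag_mat_nth)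
  ultimately have "has_eigenvalues (diag_sequence p) (\<lambda>Q. Q ** const_mpoly (diag_mat c)) (\<lambda>n. diag_mat c)"
    by (simp add: has_eigenvalues_def)
  then show ?thesis unfolding eigenvalue_algebra_def by blast
qed

lemma eigenvalue_algebra_mat_power:
  assumes "\<Lambda> \<in> eigenvalue_algebra (diag_sequence p)"
  shows "(\<lambda>n. mat_power (\<Lambda> n) k) \<in> eigenvalue_algebra (diag_sequence p)"
proof (induction k)
  case 0
  have "diag_mat (\<lambda>i. 1) = (mat 1 :: 'a cmat)"
    by (simp add: vec_eq_iff diag_mat_nth mat_nth)
  then show ?case
    using eigenvalue_algebra_diag[of "\<lambda>i. 1" p] by simp
next
  case (Suc k)
  then show ?case using eigenvalue_algebra_mult[OF Suc assms] by simp
qed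

text \<open>
  Scalar sequences \<open>p i\<close>, each made of eigenfunctions of a second-order operator
  \<open>\<rho> i \<partial>\<^sup>2 + \<tau> i \<partial>\<close>. After the normalisation by \<open>\<kappa>\<close>, the eigenvalues of an intertwiner from \<open>p i\<close>
  are polynomials in the eigenvalues \<open>e i\<close>, and a nonzero intertwiner joins sequences with the
  same eigenvalues.
\<close>

locale intertwined_eigenfunctions =
  fixes p :: "'n::finite \<Rightarrow> nat \<Rightarrow> complex poly"
    and \<rho> \<tau> :: "'n \<Rightarrow> complex poly"
    and e \<kappa> :: "'n \<Rightarrow> nat \<Rightarrow> complex"
  assumes degree_p: "degree (p i n) = n"
    and monic_p: "coeff (p i n) n = 1"
    and eigenfunction: "pderiv (pderiv (p i n)) * \<rho> i + pderiv (p i n) * \<tau> i = smult (e i n) (p i n)"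
    and normalisation: "\<kappa> i n \<noteq> 0"
    and intertwiner_polynomial:
      "intertwiner (p i) (p j) \<mu> \<Longrightarrow> \<exists>a. \<forall>n. \<mu> n * \<kappa> j n = poly a (e i n) * \<kappa> i n"
    and intertwiner_same_eigenvalues: "intertwiner (p i) (p j) \<mu> \<Longrightarrow> \<mu> n \<noteq> 0 \<Longrightarrow> e i = e j"
begin

abbreviation "P \<equiv> diag_sequence p"

lemma monic_P: "monic_sequence P"
  by (rule monic_sequence_diag_sequence) (fact degree_p monic_p)+

lemma eigenvalues_in_algebra: "(\<lambda>n. diag_mat (\<lambda>i. e i n)) \<in> eigenvalue_algebra P"
proof -
  let ?D = "\<lambda>Q :: 'n mpoly. map_matrix (pderiv ^^ 2) Q ** (\<chi> i j. if i = j then \<rho> i else 0) +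
    map_matrix (pderiv ^^ 1) Q ** (\<chi> i j. if i = j then \<tau> i else 0)"
  have "?D \<in> diff_ops"
    by (intro diff_ops_add diff_ops_term)
  moreover have "?D (P n) = const_mpoly (diag_mat (\<lambda>i. e i n)) ** P n" for n
  proof -
    have "?D (P n) $ i $ j = (const_mpoly (diag_mat (\<lambda>i. e i n)) ** P n) $ i $ j" for i j
    proof -
      have "?D (P n) $ i $ j =
          pderiv (pderiv (P n $ i $ j)) * \<rho> j + pderiv (P n $ i $ j) * \<tau> j"
        by (simp add: matrix_mult_nth if_distrib[of "\<lambda>x. _ * x"] numeral_2_eq_2 cong: if_cong)
      also have "\<dots> = smult (if i = j then e i n else 0) (p j n)"
        by (simp add: diag_sequence_def eigenfunction)
      also have "\<dots> = (const_mpoly (diag_mat (\<lambda>i. e i n)) ** P n) $ i $ j"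
        by (simp add: mult_diag_sequence_nth) (simp add: const_mpoly_def diag_mat_nth)
      finally show ?thesis .
    qed
    then show ?thesis by (simp only: vec_eq_iff) blast
  qed
  ultimately have "has_eigenvalues P ?D (\<lambda>n. diag_mat (\<lambda>i. e i n))"
    by (simp add: has_eigenvalues_def)
  then show ?thesis unfolding eigenvalue_algebra_def by blast
qed

text \<open>
  The polynomials are placed in one diagonal position at a time: different positions may need
  different polynomials.
\<close>

lemma unit_polynomial_in_algebra:
  "(\<lambda>n. diag_mat (\<lambda>a. if a = i then poly q (e i n) else 0)) \<in> eigenvalue_algebra P"
proof (induction q)
  case 0
  show ?case using eigenvalue_algebra_diag[of "\<lambda>a. 0" p] by (simp cong: if_cong)
next
  case (pCons c q)
  have "diag_mat (\<lambda>a. if a = i then poly (pCons c q) (e i n) else 0) =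
      diag_mat (\<lambda>a. if a = i then c else 0) +
      diag_mat (\<lambda>a. e a n) ** diag_mat (\<lambda>a. if a = i then poly q (e i n) else 0)" for n
    by (simp add: vec_eq_iff diag_mat_mult_nth) (simp add: diag_mat_nth)
  then show ?case
    by (simp only:)
       (intro eigenvalue_algebra_add eigenvalue_algebra_diag eigenvalue_algebra_mult eigenvalues_in_algebra pCons)
qed

text \<open>
  The block of the indices with eigenvalues \<open>\<epsilon>\<close>. It is completed by the identity, and not by zero,
  so that it is an invertible matrix of the full size.
\<close>

definition block :: "(nat \<Rightarrow> complex) \<Rightarrow> 'n cmat \<Rightarrow> 'n cmat" where
  "block \<epsilon> L = (\<chi> a b. if e a = \<epsilon> then L $ a $ b else if a = b then 1 else 0)"

lemma block_in_algebra:
  assumes "\<Lambda> \<in> eigenvalue_algebra P"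
  shows "(\<lambda>n. block \<epsilon> (\<Lambda> n)) \<in> eigenvalue_algebra P"
proof -
  have "block \<epsilon> (\<Lambda> n) = diag_mat (\<lambda>a. if e a = \<epsilon> then 1 else 0) ** \<Lambda> n +
      diag_mat (\<lambda>a. if e a = \<epsilon> then 0 else 1)" for n
    by (simp add: vec_eq_iff diag_mat_mult_nth block_def) (simp add: diag_mat_nth)
  then show ?thesis
    by (simp only:) (intro eigenvalue_algebra_add eigenvalue_algebra_diag eigenvalue_algebra_mult assms)
qed

lemma eigenvalue_entry_zero:
  assumes "\<Lambda> \<in> eigenvalue_algebra P" "e a \<noteq> e b"
  shows "\<Lambda> n $ a $ b = 0"
  using assms has_eigenvalues_entry_intertwiner[of p _ \<Lambda> a b]
    intertwiner_same_eigenvalues[of a b "\<lambda>n. \<Lambda> n $ a $ b" n]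
  unfolding eigenvalue_algebra_def by blast

text \<open>
  Entries of \<open>\<Lambda>\<close> that leave a block vanish, so the inverse of the block is the block of the inverse.
\<close>

lemma block_invertible:
  assumes \<Lambda>: "\<Lambda> \<in> eigenvalue_algebra P" and "invertible (\<Lambda> n)"
  shows "\<exists>R. block \<epsilon> (\<Lambda> n) ** R = mat 1"
proof -
  from assms(2) obtain R where R: "\<Lambda> n ** R = mat 1"
    unfolding invertible_def by blast
  define S :: "'n cmat" where
    "S = (\<chi> a b. if e a = \<epsilon> \<and> e b = \<epsilon> then R $ a $ b else if a = b then 1 else 0)"
  have "(block \<epsilon> (\<Lambda> n) ** S) $ a $ b = mat 1 $ a $ b" for a b
  proof (cases "e a = \<epsilon>")
    case False
    then have "(block \<epsilon> (\<Lambda> n) ** S) $ a $ b = S $ a $ b"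
      by (simp add: matrix_mult_nth block_def if_distrib[of "\<lambda>x. x * _"] cong: if_cong)
    with False show ?thesis by (simp add: S_def mat_nth)
  next
    case True
    show ?thesis
    proof (cases "e b = \<epsilon>")
      case eb: True
      have "(block \<epsilon> (\<Lambda> n) ** S) $ a $ b = (\<Lambda> n ** R) $ a $ b"
        unfolding matrix_mult_nth
      proof (rule sum.cong)
        fix c
        show "block \<epsilon> (\<Lambda> n) $ a $ c * S $ c $ b = \<Lambda> n $ a $ c * R $ c $ b"
          using True eb eigenvalue_entry_zero[OF \<Lambda>, of a c n]
          by (cases "e c = \<epsilon>") (auto simp: block_def S_def)
      qed simp
      then show ?thesis by (simp add: R)
    next
      case eb: False
      have "block \<epsilon> (\<Lambda> n) $ a $ c * S $ c $ b = 0" for c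
        using True eb eigenvalue_entry_zero[OF \<Lambda>, of a c n]
        by (cases "e c = \<epsilon>") (auto simp: block_def S_def)
      then have "(block \<epsilon> (\<Lambda> n) ** S) $ a $ b = 0"
        unfolding matrix_mult_nth by (intro sum.neutral) blast
      moreover have "a \<noteq> b" using True eb by auto
      ultimately show ?thesis by (simp add: mat_nth)
    qed
  qed
  then show ?thesis by (auto simp: vec_eq_iff)
qed

text \<open>
  Conjugating by \<open>\<kappa>\<close> turns the block for \<open>\<epsilon>\<close> into a matrix of polynomials in \<open>\<epsilon> n\<close>, so the
  block satisfies a polynomial identity whose coefficients are polynomials in \<open>\<epsilon> n\<close>; such
  coefficients are again eigenvalues of differential operators.
\<close>

lemma block_cayley_hamilton:
  assumes \<Lambda>: "\<Lambda> \<in> eigenvalue_algebra P" and inv: "\<And>n. invertible (\<Lambda> n)"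
  shows "\<exists>(m::nat) c. \<forall>n. (\<Sum>k<Suc m. mat (poly (c k) (\<epsilon> n)) ** mat_power (block \<epsilon> (\<Lambda> n)) k) = 0 \<and>
    poly (c 0) (\<epsilon> n) \<noteq> 0"
proof -
  from \<Lambda> obtain D where "has_eigenvalues P D \<Lambda>"
    unfolding eigenvalue_algebra_def by blast
  then have "\<forall>a b. \<exists>f. \<forall>n. \<Lambda> n $ a $ b * \<kappa> b n = poly f (e a n) * \<kappa> a n"
    using has_eigenvalues_entry_intertwiner intertwiner_polynomial by blast
  then obtain f where f: "\<And>a b n. \<Lambda> n $ a $ b * \<kappa> b n = poly (f a b) (e a n) * \<kappa> a n"
    by metis
  \<comment> \<open>The constant entries outside the block are polynomials in \<open>\<epsilon> n\<close>, too.\<close>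
  define F :: "complex poly ^ 'n ^ 'n" where
    "F = (\<chi> a b. if e a = \<epsilon> then f a b else if a = b then 1 else 0)"
  define A where "A t = map_matrix (\<lambda>q. poly q t) F" for t
  obtain m and c :: "nat \<Rightarrow> complex poly"
    where ch: "\<And>t. (\<Sum>k<Suc m. mat (poly (c k) t) ** mat_power (A t) k) = 0"
      and c0: "\<And>t. poly (c 0) t = det (- A t)"
    using polynomial_cayley_hamilton[of F] unfolding A_def by blast
  have "(\<Sum>k<Suc m. mat (poly (c k) (\<epsilon> n)) ** mat_power (block \<epsilon> (\<Lambda> n)) k) = 0 \<and> poly (c 0) (\<epsilon> n) \<noteq> 0" for n
  proof -
    let ?M = "block \<epsilon> (\<Lambda> n)" and ?A = "A (\<epsilon> n)"
    define K where "K = diag_mat (\<lambda>a. \<kappa> a n)"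
    define K' where "K' = diag_mat (\<lambda>a. 1 / \<kappa> a n)"
    have KK': "K ** K' = mat 1" and K'K: "K' ** K = mat 1"
      by (simp_all add: vec_eq_iff K_def K'_def diag_mat_mult_nth)
         (simp_all add: diag_mat_nth mat_nth normalisation)
    have conj: "?M ** K = K ** ?A"
      unfolding K_def vec_eq_iff mult_diag_mat_nth diag_mat_mult_nth
      using f by (auto simp: block_def A_def F_def mult.commute)
    have pow: "mat_power ?M k ** K = K ** mat_power ?A k" for k
    proof (induction k)
      case (Suc k)
      have "mat_power ?M (Suc k) ** K = mat_power ?M k ** (K ** ?A)"
        by (simp add: conj[symmetric] matrix_mul_assoc)
      also have "\<dots> = K ** mat_power ?A (Suc k)"
        by (simp add: matrix_mul_assoc Suc)
      finally show ?case .
    qed simp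
    have scalar: "mat t ** (K ** B) = K ** (mat t ** B)" for t B
      by (simp add: vec_eq_iff K_def mat_mult_nth diag_mat_mult_nth)
    have "(\<Sum>k<Suc m. mat (poly (c k) (\<epsilon> n)) ** mat_power ?M k) ** K =
        K ** (\<Sum>k<Suc m. mat (poly (c k) (\<epsilon> n)) ** mat_power ?A k)"
      unfolding sum_matrix_mult matrix_mult_sum_right
      by (rule sum.cong) (simp_all add: matrix_mul_assoc[symmetric] pow scalar)
    then have "(\<Sum>k<Suc m. mat (poly (c k) (\<epsilon> n)) ** mat_power ?M k) ** (K ** K') = 0"
      unfolding ch matrix_mul_assoc by simp
    then have first: "(\<Sum>k<Suc m. mat (poly (c k) (\<epsilon> n)) ** mat_power ?M k) = 0"
      by (simp add: KK')
    obtain R where R: "?M ** R = mat 1"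
      using block_invertible[OF \<Lambda> inv] by blast
    have "?A = K' ** ?M ** K"
      by (simp add: matrix_mul_assoc[symmetric] conj) (simp add: matrix_mul_assoc K'K)
    then have "?A ** (K' ** R ** K) = K' ** (?M ** (K ** K') ** R) ** K"
      by (simp add: matrix_mul_assoc)
    also have "\<dots> = mat 1" by (simp add: KK' R K'K)
    finally have "?A ** (K' ** R ** K) = mat 1" .
    then have "(- ?A) ** (- (K' ** R ** K)) = mat 1"
      by (simp add: vec_eq_iff matrix_mult_nth)
    then have "det (- ?A) * det (- (K' ** R ** K)) = 1"
      by (metis det_mul det_I)
    then have "det (- ?A) \<noteq> 0" by auto
    with first show ?thesis by (simp add: c0)
  qed
  then show ?thesis by blast
qed

text \<open>
  For an invertible eigenvalue sequence \<open>\<Lambda>\<close>, the Cayley--Hamilton relation of each block, divided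
  by the block, exhibits a multiple of the block's inverse as a polynomial in the block. Row \<open>a\<close> of
  \<open>\<Gamma>\<close> is row \<open>a\<close> of that multiple for the block containing \<open>a\<close>.
\<close>

lemma central_multiple:
  assumes \<Lambda>: "\<Lambda> \<in> eigenvalue_algebra P" and inv: "\<And>n. invertible (\<Lambda> n)"
  obtains \<Gamma> z where "\<Gamma> \<in> eigenvalue_algebra P" and "\<And>n. invertible (\<Gamma> n)"
    and "\<And>n. \<Lambda> n ** \<Gamma> n = diag_mat (\<lambda>a. z a n)" and "\<And>a b. e a = e b \<Longrightarrow> z a = z b"
proof -
  have "\<forall>\<epsilon>. \<exists>(m::nat) c. \<forall>n.
      (\<Sum>k<Suc m. mat (poly (c k) (\<epsilon> n)) ** mat_power (block \<epsilon> (\<Lambda> n)) k) = 0 \<and> poly (c 0) (\<epsilon> n) \<noteq> 0"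
    using block_cayley_hamilton[OF \<Lambda> inv] by blast
  from choice[OF this] obtain m where "\<forall>\<epsilon>. \<exists>c. \<forall>n.
      (\<Sum>k<Suc (m \<epsilon>). mat (poly (c k) (\<epsilon> n)) ** mat_power (block \<epsilon> (\<Lambda> n)) k) = 0 \<and> poly (c 0) (\<epsilon> n) \<noteq> 0"
    by blast
  from choice[OF this] obtain c where
    ch: "\<And>\<epsilon> n. (\<Sum>k<Suc (m \<epsilon>). mat (poly (c \<epsilon> k) (\<epsilon> n)) ** mat_power (block \<epsilon> (\<Lambda> n)) k) = 0"
    and c0: "\<And>\<epsilon> n. poly (c \<epsilon> 0) (\<epsilon> n) \<noteq> 0"
    by blast
  define G where "G \<epsilon> n =
    (\<Sum>k<m \<epsilon>. mat (- poly (c \<epsilon> (Suc k)) (\<epsilon> n)) ** mat_power (block \<epsilon> (\<Lambda> n)) k)" for \<epsilon> n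
  have power_comm: "M ** mat_power M k = mat_power M k ** M" for M :: "'n cmat" and k
    by (induction k) (simp_all add: matrix_mul_assoc)
  have block_G: "block \<epsilon> (\<Lambda> n) ** G \<epsilon> n = mat (poly (c \<epsilon> 0) (\<epsilon> n))" for \<epsilon> n
  proof -
    let ?M = "block \<epsilon> (\<Lambda> n)"
    have "?M ** mat t = mat t ** ?M" for t
      by (simp add: vec_eq_iff mat_mult_nth mult_mat_nth mult.commute)
    then have scalar: "?M ** (mat t ** B) = mat t ** (?M ** B)" for t B
      by (simp only: matrix_mul_assoc)
    have "?M ** G \<epsilon> n = (\<Sum>k<m \<epsilon>. mat (- poly (c \<epsilon> (Suc k)) (\<epsilon> n)) ** mat_power ?M (Suc k))"
      by (simp add: G_def matrix_mult_sum_right scalar power_comm)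
    also have "\<dots> = - (\<Sum>k<m \<epsilon>. mat (poly (c \<epsilon> (Suc k)) (\<epsilon> n)) ** mat_power ?M (Suc k))"
      by (simp add: vec_eq_iff mat_mult_nth sum_negf)
    also have "\<dots> = mat (poly (c \<epsilon> 0) (\<epsilon> n))"
    proof (rule minus_unique)
      show "(\<Sum>k<m \<epsilon>. mat (poly (c \<epsilon> (Suc k)) (\<epsilon> n)) ** mat_power ?M (Suc k)) +
          mat (poly (c \<epsilon> 0) (\<epsilon> n)) = 0"
        using ch[of \<epsilon> n] unfolding sum.lessThan_Suc_shift by (simp add: add.commute)
    qed
    finally show ?thesis .
  qed
  define \<Gamma> where "\<Gamma> n = (\<Sum>a\<in>UNIV. \<Sum>k<m (e a).
    diag_mat (\<lambda>b. if b = a then poly (- c (e a) (Suc k)) (e a n) else 0) ** mat_power (block (e a) (\<Lambda> n)) k)" for n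
  have \<Gamma>_nth: "\<Gamma> n $ a $ b = G (e a) n $ a $ b" for n a b
  proof -
    have "\<Gamma> n $ a $ b = (\<Sum>a'\<in>UNIV. if a' = a then (\<Sum>k<m (e a).
        poly (- c (e a) (Suc k)) (e a n) * mat_power (block (e a) (\<Lambda> n)) k $ a $ b) else 0)"
      unfolding \<Gamma>_def sum_component diag_mat_mult_nth by (rule sum.cong) auto
    also have "\<dots> = G (e a) n $ a $ b"
      by (simp add: G_def mat_mult_nth)
    finally show ?thesis .
  qed
  define z where "z a n = poly (c (e a) 0) (e a n)" for a n
  have prod: "\<Lambda> n ** \<Gamma> n = diag_mat (\<lambda>a. z a n)" for n
  proof -
    have "(\<Lambda> n ** \<Gamma> n) $ a $ b = diag_mat (\<lambda>a. z a n) $ a $ b" for a b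
    proof -
      have "(\<Lambda> n ** \<Gamma> n) $ a $ b = (block (e a) (\<Lambda> n) ** G (e a) n) $ a $ b"
        unfolding matrix_mult_nth \<Gamma>_nth
      proof (rule sum.cong)
        fix d
        show "\<Lambda> n $ a $ d * G (e d) n $ d $ b = block (e a) (\<Lambda> n) $ a $ d * G (e a) n $ d $ b"
          using eigenvalue_entry_zero[OF \<Lambda>, of a d n] by (cases "e a = e d") (auto simp: block_def)
      qed simp
      then show ?thesis by (simp add: block_G mat_nth diag_mat_nth z_def)
    qed
    then show ?thesis by (simp add: vec_eq_iff)
  qed
  show thesis
  proof
    show "\<Gamma> \<in> eigenvalue_algebra P"
      unfolding \<Gamma>_def[abs_def]
      by (intro eigenvalue_algebra_sum eigenvalue_algebra_mult unit_polynomial_in_algebra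
          eigenvalue_algebra_mat_power block_in_algebra \<Lambda>)
    show "invertible (\<Gamma> n)" for n
    proof -
      have "\<Lambda> n ** (\<Gamma> n ** diag_mat (\<lambda>a. 1 / z a n)) = mat 1"
        by (simp add: matrix_mul_assoc prod)
           (simp add: vec_eq_iff diag_mat_mult_nth, simp add: diag_mat_nth mat_nth z_def c0)
      then have "\<Gamma> n ** (diag_mat (\<lambda>a. 1 / z a n) ** \<Lambda> n) = mat 1"
        using matrix_left_right_inverse by (metis matrix_mul_assoc)
      then show ?thesis
        using invertible_right_inverse by blast
    qed
    show "\<Lambda> n ** \<Gamma> n = diag_mat (\<lambda>a. z a n)" for n by (rule prod)
    show "z a = z b" if "e a = e b" for a b
      by (intro ext) (simp add: z_def that)
  qed
qed

text \<open>
  The eigenvalues of \<open>D E\<close> are scalar on each block, and all eigenvalue sequences are block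
  diagonal, so they commute.
\<close>

theorem central_multiple_of_operator:
  assumes D: "has_eigenvalues P D \<Lambda>" and dp: "degree_preserving D"
  obtains E \<Theta> where "degree_preserving E" and "has_eigenvalues P (op_prod D E) \<Theta>"
    and "\<And>F \<Phi>. has_eigenvalues P F \<Phi> \<Longrightarrow> op_prod (op_prod D E) F = op_prod F (op_prod D E)"
proof -
  have inv: "invertible (\<Lambda> n)" for n
    using degree_preserving_iff_eigenvalues_invertible[OF monic_P D] dp by simp
  have \<Lambda>: "\<Lambda> \<in> eigenvalue_algebra P"
    using D unfolding eigenvalue_algebra_def by blast
  obtain \<Gamma> z where \<Gamma>: "\<Gamma> \<in> eigenvalue_algebra P" and inv': "\<And>n. invertible (\<Gamma> n)"
    and prod: "\<And>n. \<Lambda> n ** \<Gamma> n = diag_mat (\<lambda>a. z a n)" and z: "\<And>a b. e a = e b \<Longrightarrow> z a = z b"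
    using central_multiple[OF \<Lambda> inv] by blast
  obtain E where E: "has_eigenvalues P E \<Gamma>"
    using \<Gamma> unfolding eigenvalue_algebra_def by blast
  have DE: "has_eigenvalues P (op_prod D E) (\<lambda>n. diag_mat (\<lambda>a. z a n))"
    using has_eigenvalues_op_prod[OF D E] by (simp add: prod)
  show thesis
  proof
    show "degree_preserving E"
      using degree_preserving_iff_eigenvalues_invertible[OF monic_P E] inv' by simp
    show "has_eigenvalues P (op_prod D E) (\<lambda>n. diag_mat (\<lambda>a. z a n))" by (rule DE)
    fix F \<Phi> assume F: "has_eigenvalues P F \<Phi>"
    then have \<Phi>: "\<Phi> \<in> eigenvalue_algebra P"
      unfolding eigenvalue_algebra_def by blast
    have "z a n * \<Phi> n $ a $ b = \<Phi> n $ a $ b * z b n" for n a b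
      using z[of a b] eigenvalue_entry_zero[OF \<Phi>, of a b n] by (cases "e a = e b") auto
    then have "(\<lambda>n. diag_mat (\<lambda>a. z a n) ** \<Phi> n) = (\<lambda>n. \<Phi> n ** diag_mat (\<lambda>a. z a n))"
      by (simp add: fun_eq_iff vec_eq_iff diag_mat_mult_nth mult_diag_mat_nth)
    with has_eigenvalues_op_prod[OF DE F] has_eigenvalues_op_prod[OF F DE]
    show "op_prod (op_prod D E) F = op_prod F (op_prod D E)"
      using has_eigenvalues_unique_op[OF monic_P] by metis
  qed
qed

end

section \<open>Scalar intertwiners\<close>

lemma scalar_diff_op_linear:
  assumes "T \<in> scalar_diff_ops"
  shows "T (f + g) = T f + T g" and "T (smult c f) = smult c (T f)" and "T 0 = 0"
proof -
  from assms obtain m h where T: "\<And>q. T q = (\<Sum>j\<le>m. (pderiv ^^ j) q * h j)"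
    unfolding scalar_diff_ops_def by auto
  show "T (f + g) = T f + T g"
    by (simp add: T higher_pderiv_add distrib_right sum.distrib)
  have "(\<Sum>j\<le>m. smult c ((pderiv ^^ j) f * h j)) = smult c (\<Sum>j\<le>m. (pderiv ^^ j) f * h j)"
    by (intro poly_eqI) (simp add: coeff_sum sum_distrib_left)
  then show "T (smult c f) = smult c (T f)"
    by (simp add: T higher_pderiv_smult)
  show "T 0 = 0" by (simp add: T)
qed

lemma higher_pderiv_monom_falling:
  "(pderiv ^^ j) (monom (1::complex) n) = monom (\<Prod>l<j. of_nat n - of_nat l) (n - j)"
proof (induction j)
  case (Suc j)
  show ?case
  proof (cases "j \<le> n")
    case True
    then show ?thesis
      by (simp add: Suc pderiv_monom of_nat_diff mult.commute)
  next
    case False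
    then have zero: "(\<Prod>l<j. of_nat n - of_nat l :: complex) = 0"
      by (intro prod_zero) (auto intro!: bexI[of _ n])
    show ?thesis
      by (simp only: funpow.simps o_apply Suc prod.lessThan_Suc zero) simp
  qed
qed simp

text \<open>
  An intertwiner of sequences with degrees \<open>n\<close> does not raise degrees, so on the leading term its
  eigenvalue can be read off from \<open>x\<^sup>n\<close>: the term \<open>\<partial>\<^sup>j f\<close> contributes
  \<open>n (n - 1) \<dots> (n - j + 1)\<close> times a coefficient of \<open>f\<close>.
\<close>

lemma intertwiner_eigenvalue_polynomial:
  assumes deg_p: "\<And>n. degree (p n) = n" and lead_p: "\<And>n. coeff (p n) n = 1"
    and deg_q: "\<And>n. degree (q n) = n" and lead_q: "\<And>n. coeff (q n) n = 1"
    and "intertwiner p q \<mu>"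
  shows "\<exists>a. \<forall>n. \<mu> n = poly a (of_nat n)"
proof -
  from assms(5) obtain T where T: "T \<in> scalar_diff_ops" and Tp: "\<And>n. T (p n) = smult (\<mu> n) (q n)"
    unfolding intertwiner_def by blast
  from T obtain m h where T_def: "\<And>f. T f = (\<Sum>j\<le>m. (pderiv ^^ j) f * h j)"
    unfolding scalar_diff_ops_def by auto
  have high_p: "coeff (p n) k = 0" and high_q: "coeff (q n) k = 0" if "k > n" for n k
    using deg_p[of n] deg_q[of n] that by (simp_all add: coeff_eq_0)
  have filtration: "\<forall>f. (\<forall>k\<ge>n. coeff f k = 0) \<longrightarrow> (\<forall>k\<ge>n. coeff (T f) k = 0)" for n
  proof (induction n)
    case 0
    show ?case
    proof (intro allI impI)
      fix f :: "complex poly" and k :: nat assume "\<forall>k\<ge>0. coeff f k = 0"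
      then have "f = 0" by (simp add: poly_eq_iff)
      then show "coeff (T f) k = 0" by (simp add: scalar_diff_op_linear[OF T])
    qed
  next
    case (Suc n)
    show ?case
    proof (intro allI impI)
      fix f :: "complex poly" and k
      assume f: "\<forall>k\<ge>Suc n. coeff f k = 0" and k: "k \<ge> Suc n"
      let ?g = "f - smult (coeff f n) (p n)"
      have "coeff ?g k = 0" if "k \<ge> n" for k
        using f that lead_p[of n] high_p[of n k] by (cases "k = n") auto
      then have "\<forall>k\<ge>n. coeff (T ?g) k = 0" using Suc by blast
      with k have "coeff (T ?g) k = 0" by simp
      moreover have "T f = T ?g + smult (coeff f n) (T (p n))"
        using scalar_diff_op_linear(1)[OF T, of ?g "smult (coeff f n) (p n)"]
        by (simp add: scalar_diff_op_linear(2)[OF T])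
      ultimately show "coeff (T f) k = 0"
        using k high_q[of n k] by (simp add: Tp)
    qed
  qed
  define a where "a = (\<Sum>j\<le>m. smult (coeff (h j) j) (\<Prod>l<j. [:- of_nat l, 1:]))"
  have "\<mu> n = poly a (of_nat n)" for n
  proof -
    let ?g = "p n - monom 1 n"
    have "coeff ?g k = 0" if "k \<ge> n" for k
      using that lead_p[of n] high_p[of n k] by (cases "k = n") auto
    then have "coeff (T ?g) n = 0" using filtration[of n] by blast
    moreover have "T (p n) = T ?g + T (monom 1 n)"
      using scalar_diff_op_linear(1)[OF T, of ?g "monom 1 n"] by simp
    ultimately have "\<mu> n = coeff (T (monom 1 n)) n"
      using lead_q[of n] Tp[of n] by (metis add_0 coeff_add coeff_smult mult.right_neutral)
    also have "\<dots> = (\<Sum>j\<le>m. (\<Prod>l<j. of_nat n - of_nat l) * coeff (h j) j)"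
      unfolding T_def coeff_sum
    proof (rule sum.cong)
      fix j
      show "coeff ((pderiv ^^ j) (monom 1 n) * h j) n = (\<Prod>l<j. of_nat n - of_nat l) * coeff (h j) j"
      proof (cases "j \<le> n")
        case True
        then show ?thesis by (simp add: higher_pderiv_monom_falling coeff_monom_mult)
      next
        case False
        then have zero: "(\<Prod>l<j. of_nat n - of_nat l :: complex) = 0"
          by (intro prod_zero) (auto intro!: bexI[of _ n])
        show ?thesis by (simp only: higher_pderiv_monom_falling zero) simp
      qed
    qed simp
    also have "\<dots> = poly a (of_nat n)"
      by (simp add: a_def poly_sum poly_prod mult.commute)
    finally show ?thesis .
  qed
  then show ?thesis by blast
qed

text \<open>This settles the Hermite and Laguerre cases, where all eigenvalues are the same multiple of \<open>n\<close>.\<close>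

lemma intertwined_eigenfunctions_linear:
  fixes p :: "'n::finite \<Rightarrow> nat \<Rightarrow> complex poly"
  assumes deg: "\<And>i n. degree (p i n) = n" and lead: "\<And>i n. coeff (p i n) n = 1"
    and ode: "\<And>i n. pderiv (pderiv (p i n)) * \<rho> i + pderiv (p i n) * \<tau> i = smult (c * of_nat n) (p i n)"
    and "c \<noteq> 0"
  shows "intertwined_eigenfunctions p \<rho> \<tau> (\<lambda>i n. c * of_nat n) (\<lambda>i n. 1)"
proof
  fix i j \<mu> assume "intertwiner (p i) (p j) \<mu>"
  then obtain a where a: "\<And>n. \<mu> n = poly a (of_nat n)"
    using intertwiner_eigenvalue_polynomial[of "p i" "p j" \<mu>] deg lead by blast
  \<comment> \<open>A polynomial in \<open>n\<close> is one in \<open>c n\<close>.\<close>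
  have "\<forall>n. \<mu> n * 1 = poly (pcompose a [:0, 1 / c:]) (c * of_nat n) * 1"
    using \<open>c \<noteq> 0\<close> by (simp add: a poly_pcompose)
  then show "\<exists>a. \<forall>n. \<mu> n * 1 = poly a (c * of_nat n) * 1" by blast
qed (simp_all add: deg lead ode)

lemma poly_eq_0_if_naturals_roots:
  fixes f :: "complex poly"
  assumes "\<And>n::nat. poly f (of_nat n) = 0"
  shows "f = 0"
proof (rule ccontr)
  assume "f \<noteq> 0"
  then have "finite {x. poly f x = 0}" by (rule poly_roots_finite)
  then have "finite (range (of_nat :: nat \<Rightarrow> complex))"
    by (rule finite_subset[rotated]) (use assms in auto)
  moreover have "inj (of_nat :: nat \<Rightarrow> complex)"
    by (rule inj_of_nat)
  ultimately show False
    using finite_imageD infinite_UNIV_nat by blast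
qed

text \<open>
  In the Jacobi case the endpoint \<open>x = 1\<close> is a zero of the leading coefficient \<open>1 - x\<^sup>2\<close>. There the
  differentiated eigenvalue equation loses its highest derivative and becomes a two-term recursion,
  so all derivatives of an eigenfunction at \<open>1\<close> are its value there times polynomials in the
  eigenvalue that are the same for all eigenfunctions.
\<close>

lemma higher_pderiv_eigenfunction:
  fixes f :: "complex poly"
  assumes "pderiv (pderiv f) * [:1, 0, -1:] + pderiv f * [:t0, t1:] = smult e f"
  shows "(pderiv ^^ Suc (Suc k)) f * [:1, 0, -1:] + (pderiv ^^ Suc k) f * [:t0, t1 - 2 * of_nat k:] =
    smult (e + of_nat k * (of_nat k - 1) - of_nat k * t1) ((pderiv ^^ k) f)"
proof (induction k)
  case 0
  show ?case using assms by simp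
next
  case (Suc k)
  let ?g = "(pderiv ^^ k) f"
  let ?c = "e + of_nat k * (of_nat k - 1) - of_nat k * t1"
  have d1: "pderiv [:1, 0, -1:] = [:0, -2 :: complex:]"
    and d2: "pderiv [:t0, t1 - 2 * of_nat k:] = [:t1 - 2 * of_nat k:]"
    by (simp_all add: pderiv_pCons)
  have "pderiv (pderiv (pderiv ?g) * [:1, 0, -1:] + pderiv ?g * [:t0, t1 - 2 * of_nat k:]) =
      pderiv (smult ?c ?g)"
    using Suc by simp
  then have "pderiv (pderiv (pderiv ?g)) * [:1, 0, -1:] + pderiv (pderiv ?g) * [:0, -2:] +
      pderiv (pderiv ?g) * [:t0, t1 - 2 * of_nat k:] + pderiv ?g * [:t1 - 2 * of_nat k:] = smult ?c (pderiv ?g)"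
    by (simp only: pderiv_add pderiv_mult pderiv_smult d1 d2) (simp only: ac_simps)
  then have "pderiv (pderiv (pderiv ?g)) * [:1, 0, -1:] +
      pderiv (pderiv ?g) * ([:0, -2:] + [:t0, t1 - 2 * of_nat k:]) =
      smult ?c (pderiv ?g) - pderiv ?g * [:t1 - 2 * of_nat k:]"
    by (simp only: distrib_left add.assoc eq_diff_eq)
  also have "[:0, -2:] + [:t0, t1 - 2 * of_nat k:] = [:t0, t1 - 2 * of_nat (Suc k):]"
    by simp
  also have "smult ?c (pderiv ?g) - pderiv ?g * [:t1 - 2 * of_nat k:] =
      smult (e + of_nat (Suc k) * (of_nat (Suc k) - 1) - of_nat (Suc k) * t1) (pderiv ?g)"
    by (simp add: smult_diff_left[symmetric] algebra_simps)
  finally show ?case by simp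
qed

lemma derivatives_at_endpoint:
  fixes t0 t1 :: complex
  assumes nz: "\<And>k::nat. t0 + t1 - 2 * of_nat k \<noteq> 0"
  shows "\<exists>Q :: nat \<Rightarrow> complex poly. Q 1 = [:0, 1 / (t0 + t1):] \<and>
    (\<forall>f e k. pderiv (pderiv f) * [:1, 0, -1:] + pderiv f * [:t0, t1:] = smult e f \<longrightarrow>
      poly ((pderiv ^^ k) f) 1 = poly (Q k) e * poly f 1)"
proof -
  define r where "r k = of_nat k * (of_nat k - 1) - of_nat k * t1" for k :: nat
  define Q where "Q = rec_nat 1 (\<lambda>k q. smult (1 / (t0 + t1 - 2 * of_nat k)) ([:r k, 1:] * q))"
  have Q_simps: "Q 0 = 1" "Q (Suc k) = smult (1 / (t0 + t1 - 2 * of_nat k)) ([:r k, 1:] * Q k)" for k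
    by (simp_all add: Q_def)
  have "Q 1 = [:0, 1 / (t0 + t1):]"
    using Q_simps(2)[of 0] by (simp add: Q_simps(1) r_def)
  moreover have "poly ((pderiv ^^ k) f) 1 = poly (Q k) e * poly f 1"
    if ode: "pderiv (pderiv f) * [:1, 0, -1:] + pderiv f * [:t0, t1:] = smult e f" for f e k
  proof (induction k)
    case (Suc k)
    have "poly ((pderiv ^^ Suc k) f) 1 * (t0 + t1 - 2 * of_nat k) = (r k + e) * poly ((pderiv ^^ k) f) 1"
      using arg_cong[OF higher_pderiv_eigenfunction[OF ode, of k], of "\<lambda>f. poly f 1"]
      by (simp add: r_def algebra_simps)
    then have "poly ((pderiv ^^ Suc k) f) 1 =
        (r k + e) * (poly (Q k) e * poly f 1) / (t0 + t1 - 2 * of_nat k)"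
      unfolding Suc using nz[of k] by (simp only: eq_divide_eq) simp
    also have "\<dots> = poly (Q (Suc k)) e * poly f 1"
      by (simp add: Q_simps(2) distrib_right)
    finally show ?case .
  qed (simp add: Q_simps(1))
  ultimately show ?thesis by blast
qed

text \<open>
  If the value at \<open>1\<close> is zero, then so are all derivatives there, including the last one, which is a
  nonzero constant.
\<close>

lemma eigenfunction_nonzero_at_endpoint:
  fixes t0 t1 :: complex
  assumes nz: "\<And>k::nat. t0 + t1 - 2 * of_nat k \<noteq> 0"
    and ode: "pderiv (pderiv f) * [:1, 0, -1:] + pderiv f * [:t0, t1:] = smult e f"
    and "f \<noteq> 0"
  shows "poly f 1 \<noteq> 0"
proof
  assume "poly f 1 = 0"
  then have zero: "poly ((pderiv ^^ k) f) 1 = 0" for k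
    using derivatives_at_endpoint[OF nz] ode by force
  let ?g = "(pderiv ^^ degree f) f"
  have "degree ?g = 0" by (simp add: degree_higher_pderiv)
  then obtain c where c: "?g = [:c:]" by (rule degree_eq_zeroE)
  then have "?g = 0" using zero[of "degree f"] by simp
  then have "coeff ?g 0 = 0" by simp
  then have "pochhammer (1::complex) (degree f) * coeff f (degree f) = 0"
    by (simp add: coeff_higher_pderiv)
  moreover have "pochhammer (1::complex) (degree f) \<noteq> 0"
    by (simp add: pochhammer_fact[symmetric])
  ultimately show False using \<open>f \<noteq> 0\<close> by simp
qed

text \<open>
  Let \<open>T\<close> send \<open>p i n\<close> to \<open>\<mu> n\<close> times \<open>p j n\<close>. Values and first derivatives at \<open>1\<close> of both sides give
  \<open>A(e i n) e j n = B(e i n)\<close> with polynomials \<open>A\<close> and \<open>B\<close>. As \<open>e i n = - n (n + s i)\<close> is symmetric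
  under \<open>n \<mapsto> - n - s i\<close>, so is \<open>e j n = - n (n + s j)\<close> unless \<open>A = 0\<close>; hence \<open>s i = s j\<close>. Writing the
  linear coefficient of the first-order term as \<open>- 1 - s\<close> gives the eigenvalues this form; the
  numbers assumed to be nonzero are the divisors in the recursion for the derivatives at \<open>1\<close>.
\<close>

lemma intertwined_eigenfunctions_jacobi:
  fixes p :: "'n::finite \<Rightarrow> nat \<Rightarrow> complex poly" and t0 s :: "'n \<Rightarrow> complex"
  assumes deg: "\<And>i n. degree (p i n) = n" and lead: "\<And>i n. coeff (p i n) n = 1"
    and ode: "\<And>i n. pderiv (pderiv (p i n)) * [:1, 0, -1:] + pderiv (p i n) * [:t0 i, - 1 - s i:] =
      smult (- (of_nat n * (of_nat n + s i))) (p i n)"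
    and nz: "\<And>i (k::nat). t0 i + (- 1 - s i) - 2 * of_nat k \<noteq> 0"
  shows "intertwined_eigenfunctions p (\<lambda>i. [:1, 0, -1:]) (\<lambda>i. [:t0 i, - 1 - s i:])
    (\<lambda>i n. - (of_nat n * (of_nat n + s i))) (\<lambda>i n. poly (p i n) 1)"
proof -
  define e where "e i n = - (of_nat n * (of_nat n + s i))" for i and n :: nat
  have ode': "pderiv (pderiv (p i n)) * [:1, 0, -1:] + pderiv (p i n) * [:t0 i, - 1 - s i:] =
      smult (e i n) (p i n)" for i n
    unfolding e_def by (rule ode)
  have key: "\<exists>a. (\<forall>n. \<mu> n * poly (p j n) 1 = poly a (e i n) * poly (p i n) 1) \<and> (s i \<noteq> s j \<longrightarrow> a = 0)"
    if "intertwiner (p i) (p j) \<mu>" for i j \<mu>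
  proof -
    from that obtain m f where T: "\<And>n. (\<Sum>l\<le>m. (pderiv ^^ l) (p i n) * f l) = smult (\<mu> n) (p j n)"
      unfolding intertwiner_def scalar_diff_ops_def by force
    obtain Q where Q1: "Q 1 = [:0, 1 / (t0 i + (- 1 - s i)):]"
      and Q: "\<And>n k. poly ((pderiv ^^ k) (p i n)) 1 = poly (Q k) (e i n) * poly (p i n) 1"
      using derivatives_at_endpoint[OF nz[of i]] ode'[of i] by blast
    obtain Q' where Q'1: "Q' 1 = [:0, 1 / (t0 j + (- 1 - s j)):]"
      and Q': "\<And>n k. poly ((pderiv ^^ k) (p j n)) 1 = poly (Q' k) (e j n) * poly (p j n) 1"
      using derivatives_at_endpoint[OF nz[of j]] ode'[of j] by blast
    \<comment> \<open>\<open>A\<close> describes the value at \<open>1\<close> of the image of an eigenfunction, and \<open>B\<close> its first derivative there.\<close>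
    define A where "A = (\<Sum>l\<le>m. smult (poly (f l) 1) (Q l))"
    define B where "B = (\<Sum>l\<le>m. smult (poly (f l) 1) (Q (Suc l)) + smult (poly (pderiv (f l)) 1) (Q l))"
    have A: "\<mu> n * poly (p j n) 1 = poly A (e i n) * poly (p i n) 1" for n
      using arg_cong[OF T[of n], of "\<lambda>g. poly g 1", symmetric]
      by (simp add: A_def poly_sum Q sum_distrib_left algebra_simps)
    have B: "\<mu> n * poly (pderiv (p j n)) 1 = poly B (e i n) * poly (p i n) 1" for n
    proof -
      have "\<mu> n * poly (pderiv (p j n)) 1 = poly (pderiv (\<Sum>l\<le>m. (pderiv ^^ l) (p i n) * f l)) 1"
        by (simp add: T pderiv_smult)
      also have "\<dots> = (\<Sum>l\<le>m. poly ((pderiv ^^ Suc l) (p i n)) 1 * poly (f l) 1 +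
          poly ((pderiv ^^ l) (p i n)) 1 * poly (pderiv (f l)) 1)"
        by (simp add: pderiv_sum poly_sum pderiv_mult algebra_simps)
      also have "\<dots> = poly B (e i n) * poly (p i n) 1"
        unfolding Q by (simp add: B_def poly_sum sum_distrib_left algebra_simps)
      finally show ?thesis .
    qed
    define d where "d = t0 j + (- 1 - s j)"
    have d: "d \<noteq> 0" using nz[of j 0] by (simp add: d_def)
    have AB: "poly A (e i n) * e j n = d * poly B (e i n)" for n
    proof -
      have "p i n \<noteq> 0" using lead[of i n] by auto
      then have \<kappa>: "poly (p i n) 1 \<noteq> 0"
        using eigenfunction_nonzero_at_endpoint[OF nz[of i] ode'[of i n]] by blast
      have "poly (pderiv (p j n)) 1 = e j n / d * poly (p j n) 1"
        using Q'[of 1 n] by (simp add: Q'1[unfolded One_nat_def] d_def)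
      with B[of n] have "(\<mu> n * poly (p j n) 1) * e j n = d * poly B (e i n) * poly (p i n) 1"
        using d by (simp add: field_simps)
      with A[of n] \<kappa> show ?thesis by simp
    qed
    define E where "E k = [:0, - s k, -1:]" for k
    have E: "poly (E k) (of_nat n) = e k n" for k n
      by (simp add: E_def e_def algebra_simps)
    have "A = 0" if "s i \<noteq> s j"
    proof -
      have "poly (pcompose A (E i) * E j - smult d (pcompose B (E i))) (of_nat n) = 0" for n
        using AB[of n] by (simp add: poly_pcompose E)
      then have "pcompose A (E i) * E j - smult d (pcompose B (E i)) = 0"
        by (rule poly_eq_0_if_naturals_roots)
      then have identity: "poly A (poly (E i) x) * poly (E j) x = d * poly B (poly (E i) x)" for x
        by (metis eq_iff_diff_eq_0 poly_mult poly_pcompose poly_smult)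
      have reflect: "poly (E i) (- x - s i) = poly (E i) x" for x
        by (simp add: E_def algebra_simps)
      have "poly (pcompose A (E i) * [:s i, 2:]) x = 0" for x
      proof -
        have "poly A (poly (E i) x) * (poly (E j) x - poly (E j) (- x - s i)) = 0"
          using identity[of x] identity[of "- x - s i"] unfolding reflect
          by (simp add: right_diff_distrib)
        moreover have "poly (E j) x - poly (E j) (- x - s i) = (s i - s j) * (2 * x + s i)"
          by (simp add: E_def algebra_simps)
        ultimately have "poly A (poly (E i) x) * (s i + 2 * x) = 0"
          using that by (auto simp: add.commute)
        then show ?thesis
          by (simp only: poly_mult poly_pcompose) (simp add: mult.commute)
      qed
      then have "pcompose A (E i) * [:s i, 2:] = 0"
        using poly_all_0_iff_0 by blast
      then have "pcompose A (E i) = 0"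
        by (simp only: mult_eq_0_iff) simp
      then show "A = 0"
        by (rule pcompose_eq_0) (simp add: E_def)
    qed
    with A show ?thesis by blast
  qed
  have "intertwined_eigenfunctions p (\<lambda>i. [:1, 0, -1:]) (\<lambda>i. [:t0 i, - 1 - s i:]) e (\<lambda>i n. poly (p i n) 1)"
  proof
    show "degree (p i n) = n" "coeff (p i n) n = 1" for i n
      by (fact deg lead)+
    show "pderiv (pderiv (p i n)) * [:1, 0, -1:] + pderiv (p i n) * [:t0 i, - 1 - s i:] =
      smult (e i n) (p i n)" for i n
      by (rule ode')
    show \<kappa>: "poly (p i n) 1 \<noteq> 0" for i n
    proof -
      have "p i n \<noteq> 0" using lead[of i n] by auto
      then show ?thesis
        using eigenfunction_nonzero_at_endpoint[OF nz[of i] ode'[of i n]] by blast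
    qed
    show "\<exists>a. \<forall>n. \<mu> n * poly (p j n) 1 = poly a (e i n) * poly (p i n) 1"
      if "intertwiner (p i) (p j) \<mu>" for i j \<mu>
      using key[OF that] by blast
    show "e i = e j" if "intertwiner (p i) (p j) \<mu>" "\<mu> n \<noteq> 0" for i j \<mu> n
    proof (rule ccontr)
      assume "e i \<noteq> e j"
      then have "s i \<noteq> s j" by (auto simp: e_def fun_eq_iff)
      with key[OF that(1)] have "\<mu> n * poly (p j n) 1 = 0" by auto
      with \<kappa>[of j n] that(2) show False by simp
    qed
  qed
  then show ?thesis by (simp add: e_def[abs_def])
qed

section \<open>Orthogonal polynomials of a functional with a Pearson equation\<close>

definition real_poly :: "complex poly \<Rightarrow> bool" where
  "real_poly f \<longleftrightarrow> (\<forall>k. coeff f k \<in> \<real>)"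

lemma real_poly_mult: "real_poly f \<Longrightarrow> real_poly g \<Longrightarrow> real_poly (f * g)"
  by (simp add: real_poly_def coeff_mult)

lemma real_poly_diff: "real_poly f \<Longrightarrow> real_poly g \<Longrightarrow> real_poly (f - g)"
  by (simp add: real_poly_def)

lemma real_poly_add: "real_poly f \<Longrightarrow> real_poly g \<Longrightarrow> real_poly (f + g)"
  by (simp add: real_poly_def)

lemma real_poly_smult: "c \<in> \<real> \<Longrightarrow> real_poly f \<Longrightarrow> real_poly (smult c f)"
  by (simp add: real_poly_def)

lemma real_poly_sum: "(\<And>x. x \<in> S \<Longrightarrow> real_poly (f x)) \<Longrightarrow> real_poly (sum f S)"
  by (simp add: real_poly_def coeff_sum)

lemma real_poly_monom: "c \<in> \<real> \<Longrightarrow> real_poly (monom c n)"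
  by (simp add: real_poly_def)

lemma real_poly_pderiv: "real_poly f \<Longrightarrow> real_poly (pderiv f)"
  by (simp add: real_poly_def coeff_pderiv)

lemma real_poly_pCons: "c \<in> \<real> \<Longrightarrow> real_poly f \<Longrightarrow> real_poly (pCons c f)"
  by (simp add: real_poly_def coeff_pCons split: nat.split)

lemma real_poly_0: "real_poly 0"
  by (simp add: real_poly_def)

text \<open>
  The abstract properties of \<open>f \<mapsto> \<integral> f w\<close> for a positive weight with \<open>(\<rho> w)' = \<tau> w\<close>, where
  \<open>\<rho> = r0 + r1 x + r2 x\<^sup>2\<close> and \<open>\<tau> = t0 + t1 x\<close>. The functional is bilinear in products, without
  conjugation: on real polynomials this is the inner product.
\<close>

locale pearson_functional =
  fixes L :: "complex poly \<Rightarrow> complex" and r0 r1 r2 t0 t1 :: complex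
  assumes L_add: "L (f + g) = L f + L g"
    and L_smult: "L (smult c f) = c * L f"
    and L_real: "real_poly f \<Longrightarrow> L f \<in> \<real>"
    and L_definite: "real_poly f \<Longrightarrow> f \<noteq> 0 \<Longrightarrow> L (f * f) \<noteq> 0"
    and pearson: "L ([:r0, r1, r2:] * pderiv h + [:t0, t1:] * h) = 0"
    and real_coeffs: "r0 \<in> \<real>" "r1 \<in> \<real>" "r2 \<in> \<real>" "t0 \<in> \<real>" "t1 \<in> \<real>"
begin

lemma L_0: "L 0 = 0"
  using L_smult[of 0 0] by simp

lemma L_diff: "L (f - g) = L f - L g"
  using L_add[of "f - g" g] by simp

lemma L_sum: "L (sum f S) = (\<Sum>x\<in>S. L (f x))"
  by (induction S rule: infinite_finite_induct) (simp_all add: L_0 L_add)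

definition \<delta> :: "complex poly \<Rightarrow> complex poly" where
  "\<delta> f = pderiv (pderiv f) * [:r0, r1, r2:] + pderiv f * [:t0, t1:]"

text \<open>
  The difference of the two products is \<open>\<rho> h' + \<tau> h\<close> for the Wronskian
  \<open>h = f' g - f g'\<close>.
\<close>

lemma \<delta>_symmetric: "L (\<delta> f * g) = L (f * \<delta> g)"
proof -
  let ?h = "pderiv f * g - f * pderiv g"
  have "\<delta> f * g - f * \<delta> g = [:r0, r1, r2:] * pderiv ?h + [:t0, t1:] * ?h"
    unfolding \<delta>_def pderiv_diff pderiv_mult by (simp only: algebra_simps)
  then show ?thesis
    using pearson[of ?h] L_diff[of "\<delta> f * g" "f * \<delta> g"] by simp
qed

text \<open>
  The coefficient at \<open>x\<^sup>k\<close> involves only coefficients of \<open>f\<close> from \<open>k\<close> on, and the one at \<open>k\<close> is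
  multiplied by the eigenvalue.
\<close>

lemma coeff_\<delta>:
  "coeff (\<delta> f) k =
     r0 * of_nat (Suc k) * of_nat (Suc (Suc k)) * coeff f (Suc (Suc k)) +
     (r1 * of_nat k + t0) * of_nat (Suc k) * coeff f (Suc k) +
     (r2 * (of_nat k - 1) + t1) * of_nat k * coeff f k"
proof (cases k)
  case 0
  then show ?thesis
    by (simp add: \<delta>_def mult.commute[of _ "[:_, _:]"] mult.commute[of _ "[:_, _, _:]"] coeff_pderiv)
next
  case (Suc l)
  then show ?thesis
    by (cases l)
      (simp_all add: \<delta>_def mult.commute[of _ "[:_, _:]"] mult.commute[of _ "[:_, _, _:]"]
        coeff_pderiv algebra_simps)
qed

lemma \<delta>_real: "real_poly f \<Longrightarrow> real_poly (\<delta> f)"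
  unfolding \<delta>_def
  by (intro real_poly_add real_poly_mult real_poly_pderiv real_poly_pCons real_poly_0 real_coeffs)

lemma \<delta>_degree: "(\<And>k. n \<le> k \<Longrightarrow> coeff f k = 0) \<Longrightarrow> n \<le> k \<Longrightarrow> coeff (\<delta> f) k = 0"
  by (simp add: coeff_\<delta>)

text \<open>
  Gram--Schmidt. Only \<open>L (f * f)\<close> for real \<open>f\<close> is known to be nonzero, so the construction has to
  stay within real polynomials.
\<close>

lemma orthogonal_to_lower_degree:
  "\<exists>p. degree p = n \<and> coeff p n = 1 \<and> real_poly p \<and> (\<forall>f. (\<forall>k\<ge>n. coeff f k = 0) \<longrightarrow> L (p * f) = 0)"
proof (induction n rule: less_induct)
  case (less n)
  then have "\<forall>m. \<exists>p. m < n \<longrightarrow> degree p = m \<and> coeff p m = 1 \<and> real_poly p \<and>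
      (\<forall>f. (\<forall>k\<ge>m. coeff f k = 0) \<longrightarrow> L (p * f) = 0)"
    by blast
  from choice[OF this] obtain q where
    deg: "\<And>m. m < n \<Longrightarrow> degree (q m) = m" and lead: "\<And>m. m < n \<Longrightarrow> coeff (q m) m = 1"
    and real: "\<And>m. m < n \<Longrightarrow> real_poly (q m)"
    and orth: "\<And>m f. m < n \<Longrightarrow> (\<forall>k\<ge>m. coeff f k = 0) \<Longrightarrow> L (q m * f) = 0"
    by blast
  have high: "coeff (q m) k = 0" if "m < n" "m < k" for m k
    using deg[of m] that by (simp add: coeff_eq_0)
  have pair: "L (q m * q l) = 0" if "m < n" "l < n" "m \<noteq> l" for m l
  proof (cases "l < m")
    case True
    then show ?thesis using orth[of m "q l"] high[of l] that by simp
  next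
    case False
    then have "L (q l * q m) = 0" using orth[of l "q m"] high[of m] that by simp
    then show ?thesis by (simp add: mult.commute)
  qed
  have norm: "L (q m * q m) \<noteq> 0" if "m < n" for m
  proof -
    have "q m \<noteq> 0" using lead[OF that] by (metis coeff_0 zero_neq_one)
    with L_definite real[OF that] show ?thesis by blast
  qed
  define p where "p = monom 1 n - (\<Sum>m<n. smult (L (monom 1 n * q m) / L (q m * q m)) (q m))"
  have p_coeff: "coeff p k = (if k = n then 1 else 0)" if "k \<ge> n" for k
    using that high by (simp add: p_def coeff_sum)
  have p_real: "real_poly p"
    unfolding p_def
    by (intro real_poly_diff real_poly_sum real_poly_smult real_poly_monom Reals_divide L_real real_poly_mult)
       (auto intro: real)
  have p_orth: "L (p * q l) = 0" if "l < n" for l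
  proof -
    have "(\<Sum>m<n. L (monom 1 n * q m) / L (q m * q m) * L (q m * q l)) =
        (\<Sum>m<n. if m = l then L (monom 1 n * q l) else 0)"
      using that pair norm by (intro sum.cong) auto
    also have "\<dots> = L (monom 1 n * q l)"
      using that by simp
    finally show ?thesis
      by (simp add: p_def left_diff_distrib L_diff sum_distrib_right L_sum L_smult)
  qed
  have p_lower: "\<forall>f. (\<forall>k\<ge>d. coeff f k = 0) \<longrightarrow> L (p * f) = 0" if "d \<le> n" for d
    using that
  proof (induction d)
    case 0
    show ?case
    proof (intro allI impI)
      fix f :: "complex poly" assume "\<forall>k\<ge>0. coeff f k = 0"
      then have "f = 0" by (simp add: poly_eq_iff)
      then show "L (p * f) = 0" by (simp add: L_0)
    qed
  next
    case (Suc d)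
    show ?case
    proof (intro allI impI)
      fix f :: "complex poly" assume f: "\<forall>k\<ge>Suc d. coeff f k = 0"
      let ?g = "f - smult (coeff f d) (q d)"
      have "coeff ?g k = 0" if "k \<ge> d" for k
        using f that lead[of d] high[of d k] Suc.prems by (cases "k = d") auto
      then have "\<forall>k\<ge>d. coeff ?g k = 0" by blast
      moreover have "d \<le> n" using Suc.prems by simp
      ultimately have "L (p * ?g) = 0" using Suc.IH by blast
      moreover have "L (p * f) = L (p * ?g) + coeff f d * L (p * q d)"
        by (simp add: right_diff_distrib L_diff L_smult)
      ultimately show "L (p * f) = 0" using p_orth Suc.prems by simp
    qed
  qed
  have "degree p = n"
    using p_coeff by (intro antisym degree_le le_degree) auto
  then show ?case
    using p_coeff[of n] p_real p_lower[of n] by auto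
qed

text \<open>
  The operator \<open>\<delta>\<close> is symmetric and does not raise degrees, so \<open>\<delta> p\<close> minus the right multiple of
  \<open>p\<close> has lower degree and is orthogonal to all polynomials of lower degree, including itself.
\<close>

theorem orthogonal_eigenfunctions:
  "\<exists>p. (\<forall>n. degree (p n) = n) \<and> (\<forall>n. coeff (p n) n = 1) \<and> (\<forall>n. real_poly (p n)) \<and>
    (\<forall>n f. (\<forall>k\<ge>n. coeff f k = 0) \<longrightarrow> L (p n * f) = 0) \<and>
    (\<forall>n. pderiv (pderiv (p n)) * [:r0, r1, r2:] + pderiv (p n) * [:t0, t1:] =
      smult ((r2 * (of_nat n - 1) + t1) * of_nat n) (p n))"
proof -
  have "\<forall>n. \<exists>p. degree p = n \<and> coeff p n = 1 \<and> real_poly p \<and> (\<forall>f. (\<forall>k\<ge>n. coeff f k = 0) \<longrightarrow> L (p * f) = 0)"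
    using orthogonal_to_lower_degree by blast
  from choice[OF this] obtain p where
    deg: "\<And>n. degree (p n) = n" and lead: "\<And>n. coeff (p n) n = 1"
    and real: "\<And>n. real_poly (p n)"
    and orth: "\<And>n f. (\<forall>k\<ge>n. coeff f k = 0) \<Longrightarrow> L (p n * f) = 0"
    by blast
  have high: "coeff (p m) k = 0" if "m < k" for m k
    using deg[of m] that by (simp add: coeff_eq_0)
  show ?thesis
  proof (intro exI conjI allI impI)
    show "degree (p n) = n" "coeff (p n) n = 1" "real_poly (p n)" for n
      by (fact deg lead real)+
    show "L (p n * f) = 0" if "\<forall>k\<ge>n. coeff f k = 0" for n f
      using that by (rule orth)
    fix n
    let ?e = "(r2 * (of_nat n - 1) + t1) * of_nat n"
    let ?R = "\<delta> (p n) - smult ?e (p n)"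
    have low: "coeff ?R k = 0" if "k \<ge> n" for k
      using that high[of n] lead[of n] by (cases "k = n") (auto simp: coeff_\<delta>)
    have "L (?R * f) = 0" if f: "\<forall>k\<ge>n. coeff f k = 0" for f
    proof -
      have "L (\<delta> (p n) * f) = L (p n * \<delta> f)" by (rule \<delta>_symmetric)
      also have "\<dots> = 0" using f \<delta>_degree[of n f] by (intro orth) blast
      finally show ?thesis
        using orth[OF f] by (simp add: left_diff_distrib L_diff L_smult)
    qed
    then have "L (?R * ?R) = 0" using low by blast
    moreover have "real_poly ?R"
      by (intro real_poly_diff \<delta>_real real_poly_smult real Reals_mult Reals_add Reals_diff real_coeffs) auto
    ultimately have "?R = 0" using L_definite by blast
    then show "pderiv (pderiv (p n)) * [:r0, r1, r2:] + pderiv (p n) * [:t0, t1:] = smult ?e (p n)"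
      by (simp add: \<delta>_def)
  qed
qed

end

section \<open>Classical weights\<close>

definition weight_functional :: "ereal \<Rightarrow> ereal \<Rightarrow> (real \<Rightarrow> real) \<Rightarrow> complex poly \<Rightarrow> complex" where
  "weight_functional x0 x1 w f = (LINT x:einterval x0 x1|lborel. poly f (of_real x) * of_real (w x))"

definition has_moments :: "ereal \<Rightarrow> ereal \<Rightarrow> (real \<Rightarrow> real) \<Rightarrow> bool" where
  "has_moments x0 x1 w \<longleftrightarrow> (\<forall>k. set_integrable lborel (einterval x0 x1) (\<lambda>x. x ^ k * w x))"

lemma poly_weight_integrable:
  assumes "has_moments x0 x1 w"
  shows "set_integrable lborel (einterval x0 x1) (\<lambda>x. poly f (complex_of_real x) * of_real (w x))"
proof -
  have "integrable lborel (\<lambda>x. \<Sum>k\<le>degree f. coeff f k * complex_of_real (indicator (einterval x0 x1) x *\<^sub>R (x ^ k * w x)))"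
    using assms unfolding has_moments_def set_integrable_def
    by (intro Bochner_Integration.integrable_sum integrable_mult_right integrable_of_real) blast
  moreover have "(\<Sum>k\<le>degree f. coeff f k * complex_of_real (indicator (einterval x0 x1) x *\<^sub>R (x ^ k * w x))) =
      indicator (einterval x0 x1) x *\<^sub>R (poly f (complex_of_real x) * of_real (w x))" for x
    by (simp add: poly_altdef sum_distrib_left sum_distrib_right scaleR_conv_of_real algebra_simps)
  ultimately show ?thesis unfolding set_integrable_def by simp
qed

lemma weight_functional_cong:
  assumes "\<And>x. x \<in> einterval x0 x1 \<Longrightarrow> w x = u x"
  shows "weight_functional x0 x1 w = weight_functional x0 x1 u"
  unfolding weight_functional_def fun_eq_iff
  by (intro allI set_lebesgue_integral_cong) (simp_all add: assms)

lemma has_moments_cong: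
  assumes "\<And>x. x \<in> einterval x0 x1 \<Longrightarrow> w x = u x"
  shows "has_moments x0 x1 w = has_moments x0 x1 u"
  unfolding has_moments_def by (intro all_cong1 set_integrable_cong) (simp_all add: assms)

lemma real_poly_of_real:
  assumes "real_poly f"
  shows "poly f (complex_of_real x) = of_real (Re (poly f (of_real x)))"
proof -
  have "poly f (complex_of_real x) \<in> \<real>"
    using assms unfolding real_poly_def poly_altdef by (intro sum_in_Reals Reals_mult Reals_power) auto
  then show ?thesis by (simp add: complex_is_Real_iff complex_eq_iff)
qed

text \<open>
  A positive weight with \<open>(\<rho> w)' = \<tau> w\<close>, where \<open>\<rho> w\<close> times any power vanishes at the endpoints:
  integrating \<open>(\<rho> w h)'\<close> gives the Pearson equation for the functional.
\<close>

lemma pearson_functional_weight: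
  fixes w :: "real \<Rightarrow> real" and r0 r1 r2 t0 t1 :: real
  assumes mom: "has_moments x0 x1 w"
    and I: "{0<..<1} \<subseteq> einterval x0 x1"
    and pos: "\<And>x. x \<in> einterval x0 x1 \<Longrightarrow> 0 < w x"
    and cont: "\<And>x. x \<in> einterval x0 x1 \<Longrightarrow> isCont w x"
    and deriv: "\<And>x. x \<in> einterval x0 x1 \<Longrightarrow>
      ((\<lambda>x. (r0 + r1 * x + r2 * x\<^sup>2) * w x) has_real_derivative (t0 + t1 * x) * w x) (at x)"
    and lim0: "\<And>k. (((\<lambda>x. (r0 + r1 * x + r2 * x\<^sup>2) * w x * x ^ k) \<circ> real_of_ereal) \<longlongrightarrow> 0) (at_right x0)"
    and lim1: "\<And>k. (((\<lambda>x. (r0 + r1 * x + r2 * x\<^sup>2) * w x * x ^ k) \<circ> real_of_ereal) \<longlongrightarrow> 0) (at_left x1)"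
  shows "pearson_functional (weight_functional x0 x1 w) (of_real r0) (of_real r1) (of_real r2) (of_real t0) (of_real t1)"
proof
  let ?I = "einterval x0 x1"
  note integrable = poly_weight_integrable[OF mom]
  have "(1/2::real) \<in> ?I" using I by auto
  then have less: "x0 < x1" unfolding einterval_def by (auto intro: less_trans)
  show "weight_functional x0 x1 w (f + g) = weight_functional x0 x1 w f + weight_functional x0 x1 w g" for f g
    unfolding weight_functional_def poly_add distrib_right
    by (rule set_integral_add) (rule integrable)+
  show "weight_functional x0 x1 w (smult c f) = c * weight_functional x0 x1 w f" for c f
    by (simp add: weight_functional_def mult.assoc)
  have as_real: "weight_functional x0 x1 w f = of_real (LINT x:?I|lborel. Re (poly f (of_real x)) * w x)"
    if "real_poly f" for f
  proof -
    have "weight_functional x0 x1 w f = (LINT x:?I|lborel. complex_of_real (Re (poly f (of_real x)) * w x))"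
      unfolding weight_functional_def by (simp add: real_poly_of_real[OF that, symmetric])
    also have "\<dots> = of_real (LINT x:?I|lborel. Re (poly f (of_real x)) * w x)"
      by (rule set_integral_complex_of_real)
    finally show ?thesis .
  qed
  then show "weight_functional x0 x1 w f \<in> \<real>" if "real_poly f" for f
    using that by simp
  show "weight_functional x0 x1 w (f * f) \<noteq> 0" if "real_poly f" "f \<noteq> 0" for f
  proof
    assume zero: "weight_functional x0 x1 w (f * f) = 0"
    \<comment> \<open>A vanishing integral of a nonnegative function makes \<open>f\<close> zero almost everywhere on the interval,
      whereas \<open>f\<close> has finitely many roots and \<open>{0<..<1}\<close> is not a null set.\<close>
    let ?g = "\<lambda>x. indicator ?I x *\<^sub>R ((Re (poly f (of_real x)))\<^sup>2 * w x)"
    have sq: "Re (poly (f * f) (of_real x)) = (Re (poly f (of_real x)))\<^sup>2" for x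
    proof -
      have "poly (f * f) (of_real x) = complex_of_real (Re (poly f (of_real x))) * complex_of_real (Re (poly f (of_real x)))"
        using real_poly_of_real[OF that(1), of x] by (metis poly_mult)
      then show ?thesis by (simp add: power2_eq_square)
    qed
    have "integrable lborel (\<lambda>x. Re (indicator ?I x *\<^sub>R (poly (f * f) (complex_of_real x) * of_real (w x))))"
      using integrable[of "f * f"] unfolding set_integrable_def by (rule integrable_Re)
    then have int: "integrable lborel ?g"
      by (simp add: sq[symmetric] del: poly_mult)
    have "integral\<^sup>L lborel ?g = 0"
      using zero as_real[OF real_poly_mult[OF that(1) that(1)]]
      by (simp add: sq set_lebesgue_integral_def del: poly_mult)
    moreover have "AE x in lborel. 0 \<le> ?g x"
      using less_imp_le[OF pos] by (auto simp: indicator_def)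
    ultimately have "AE x in lborel. ?g x = 0"
      using integral_nonneg_eq_0_iff_AE[OF int] by blast
    then have ae: "AE x in lborel. x \<in> ?I \<longrightarrow> poly f (complex_of_real x) = 0"
    proof (rule AE_mp, intro AE_I2 impI)
      fix x assume "?g x = 0" "x \<in> ?I"
      then have "Re (poly f (of_real x)) = 0" using pos[of x] by simp
      then show "poly f (complex_of_real x) = 0" using real_poly_of_real[OF that(1), of x] by simp
    qed
    have "finite {z. poly f z = 0}" using that(2) by (rule poly_roots_finite)
    then have "finite (complex_of_real -` {z. poly f z = 0})"
      by (rule finite_vimageI) (simp add: inj_of_real)
    then have fin: "finite {x. poly f (complex_of_real x) = 0}"
      by (simp add: vimage_def)
    have "AE x in lborel. x \<notin> {x. poly f (complex_of_real x) = 0}"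
      by (rule AE_not_in) (rule finite_imp_null_set_lborel[OF fin])
    with ae have "AE x in lborel. x \<notin> {0<..<1::real}"
      by eventually_elim (use I in auto)
    then have "{0<..<1::real} \<in> null_sets lborel"
      using AE_iff_null_sets[of "{0<..<1::real}" lborel] by simp
    then have "emeasure lborel {0<..<1::real} = 0" by (rule null_setsD1)
    then show False by simp
  qed
  show "weight_functional x0 x1 w ([:of_real r0, of_real r1, of_real r2:] * pderiv h + [:of_real t0, of_real t1:] * h) = 0" for h
  proof -
    let ?q = "[:of_real r0, of_real r1, of_real r2:] * pderiv h + [:of_real t0, of_real t1:] * h"
    let ?f = "\<lambda>x. poly ?q (complex_of_real x) * of_real (w x)"
    define g where "g x = (r0 + r1 * x + r2 * x\<^sup>2) * w x" for x
    let ?F = "\<lambda>x. complex_of_real (g x) * poly h (of_real x)"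
    have F_sum: "?F x = (\<Sum>k\<le>degree h. coeff h k * complex_of_real (g x * x ^ k))" for x
      by (simp add: poly_altdef sum_distrib_left algebra_simps)
    have lim: "((?F \<circ> real_of_ereal) \<longlongrightarrow> 0) A"
      if "\<And>k. (((\<lambda>x. g x * x ^ k) \<circ> real_of_ereal) \<longlongrightarrow> 0) A" for A
    proof -
      have "((\<lambda>y. \<Sum>k\<le>degree h. coeff h k * complex_of_real (((\<lambda>x. g x * x ^ k) \<circ> real_of_ereal) y))
          \<longlongrightarrow> (\<Sum>k\<le>degree h. coeff h k * complex_of_real 0)) A"
        by (intro tendsto_sum tendsto_mult tendsto_const tendsto_of_real that)
      then show ?thesis by (simp add: F_sum o_def)
    qed
    have "(LBINT x=x0..x1. ?f x) = 0 - 0"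
    proof (rule interval_integral_FTC_integrable[where F = ?F])
      show "x0 < x1" by (rule less)
      fix x assume "x0 < ereal x" "ereal x < x1"
      then have x: "x \<in> ?I" by (simp add: einterval_def)
      have "((\<lambda>x. complex_of_real (g x)) has_vector_derivative of_real ((t0 + t1 * x) * w x)) (at x)"
        using deriv[OF x] unfolding g_def by (rule has_vector_derivative_of_real)
      moreover have "((\<lambda>x. poly h (complex_of_real x)) has_vector_derivative poly (pderiv h) (of_real x)) (at x)"
        by (rule has_vector_derivative_real_field) (rule poly_DERIV)
      ultimately have "(?F has_vector_derivative complex_of_real (g x) * poly (pderiv h) (of_real x) +
          of_real ((t0 + t1 * x) * w x) * poly h (of_real x)) (at x)"
        by (rule has_vector_derivative_mult)
      then show "(?F has_vector_derivative ?f x) (at x)"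
        by (simp add: g_def algebra_simps power2_eq_square)
      show "isCont ?f x"
        using cont[OF x] by (intro continuous_intros) auto
    next
      show "set_integrable lborel ?I ?f" by (rule integrable)
      show "((?F \<circ> real_of_ereal) \<longlongrightarrow> 0) (at_right x0)"
        using lim0 by (intro lim) (simp add: g_def)
      show "((?F \<circ> real_of_ereal) \<longlongrightarrow> 0) (at_left x1)"
        using lim1 by (intro lim) (simp add: g_def)
    qed
    then show ?thesis
      using less by (simp add: weight_functional_def interval_lebesgue_integral_le_eq)
  qed
qed auto

text \<open>
  It remains to differentiate \<open>\<rho> w\<close> for each family and to check that it vanishes at the endpoints;
  at a finite endpoint this is where the exponents being above \<open>-1\<close> enters, since \<open>\<rho>\<close> contributes
  one more factor.
\<close>

lemma pearson_functional_hermite: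
  assumes "has_moments (- \<infinity>) \<infinity> (hermite_weight b)"
  shows "pearson_functional (weight_functional (- \<infinity>) \<infinity> (hermite_weight b)) 1 0 0 (of_real (2 * b)) (-2)"
proof -
  have "pearson_functional (weight_functional (- \<infinity>) \<infinity> (hermite_weight b))
    (of_real 1) (of_real 0) (of_real 0) (of_real (2 * b)) (of_real (-2))"
  proof (rule pearson_functional_weight[OF assms])
    show "((\<lambda>x. (1 + 0 * x + 0 * x\<^sup>2) * hermite_weight b x) has_real_derivative
        (2 * b + -2 * x) * hermite_weight b x) (at x)" for x
      unfolding hermite_weight_def by (auto intro!: derivative_eq_intros)
    show "isCont (hermite_weight b) x" for x
      unfolding hermite_weight_def by (intro continuous_intros)
    have "((\<lambda>x. exp (- x\<^sup>2 + 2 * b * x) * x ^ k) \<longlongrightarrow> 0) at_bot" for k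
      by real_asymp
    then show "(((\<lambda>x. (1 + 0 * x + 0 * x\<^sup>2) * hermite_weight b x * x ^ k) \<circ> real_of_ereal) \<longlongrightarrow> 0)
        (at_right (- \<infinity>))" for k
      by (simp add: ereal_tendsto_simps hermite_weight_def)
    have "((\<lambda>x. exp (- x\<^sup>2 + 2 * b * x) * x ^ k) \<longlongrightarrow> 0) at_top" for k
      by real_asymp
    then show "(((\<lambda>x. (1 + 0 * x + 0 * x\<^sup>2) * hermite_weight b x * x ^ k) \<circ> real_of_ereal) \<longlongrightarrow> 0)
        (at_left \<infinity>)" for k
      by (simp add: ereal_tendsto_simps hermite_weight_def)
  qed (auto simp: hermite_weight_def)
  then show ?thesis by simp
qed

lemma pearson_functional_laguerre:
  assumes "has_moments 0 \<infinity> (laguerre_weight \<alpha>)" and \<alpha>: "\<alpha> > -1"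
  shows "pearson_functional (weight_functional 0 \<infinity> (laguerre_weight \<alpha>)) 0 1 0 (of_real (\<alpha> + 1)) (-1)"
proof -
  have "pearson_functional (weight_functional 0 \<infinity> (laguerre_weight \<alpha>))
    (of_real 0) (of_real 1) (of_real 0) (of_real (\<alpha> + 1)) (of_real (-1))"
  proof (rule pearson_functional_weight[OF assms(1)])
    show "((\<lambda>x. (0 + 1 * x + 0 * x\<^sup>2) * laguerre_weight \<alpha> x) has_real_derivative
        (\<alpha> + 1 + -1 * x) * laguerre_weight \<alpha> x) (at x)" if "x \<in> einterval 0 \<infinity>" for x
    proof -
      have "x > 0" using that by (simp add: einterval_def)
      then show ?thesis
        unfolding laguerre_weight_def
        by (auto intro!: derivative_eq_intros simp: powr_diff field_simps)
    qed
    show "isCont (laguerre_weight \<alpha>) x" if "x \<in> einterval 0 \<infinity>" for x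
      using that unfolding laguerre_weight_def einterval_def by (auto intro!: continuous_intros)
    show "(((\<lambda>x. (0 + 1 * x + 0 * x\<^sup>2) * laguerre_weight \<alpha> x * x ^ k) \<circ> real_of_ereal) \<longlongrightarrow> 0)
        (at_right 0)" for k
    proof -
      have "((\<lambda>x::real. x powr (\<alpha> + 1)) \<longlongrightarrow> 0) (at_right 0)"
        using \<alpha> by real_asymp
      moreover have "((\<lambda>x::real. exp (- x) * x ^ k) \<longlongrightarrow> exp (- 0) * 0 ^ k) (at_right 0)"
        by (intro tendsto_intros)
      ultimately have "((\<lambda>x. x powr (\<alpha> + 1) * (exp (- x) * x ^ k)) \<longlongrightarrow> 0 * (exp (- 0) * 0 ^ k)) (at_right 0)"
        by (rule tendsto_mult)
      moreover have "\<forall>\<^sub>F x in at_right 0. x powr (\<alpha> + 1) * (exp (- x) * x ^ k) =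
          (0 + 1 * x + 0 * x\<^sup>2) * laguerre_weight \<alpha> x * x ^ k"
        using eventually_at_right_less[of "0::real"]
        by eventually_elim (simp add: laguerre_weight_def powr_add)
      ultimately have "((\<lambda>x. (0 + 1 * x + 0 * x\<^sup>2) * laguerre_weight \<alpha> x * x ^ k) \<longlongrightarrow> 0) (at_right 0)"
        by (simp add: tendsto_cong)
      then show ?thesis unfolding zero_ereal_def ereal_tendsto_simps .
    qed
    have "((\<lambda>x. x * (exp (- x) * x powr \<alpha>) * x ^ k) \<longlongrightarrow> 0) at_top" for k
      by real_asymp
    then show "(((\<lambda>x. (0 + 1 * x + 0 * x\<^sup>2) * laguerre_weight \<alpha> x * x ^ k) \<circ> real_of_ereal) \<longlongrightarrow> 0)
        (at_left \<infinity>)" for k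
      by (simp add: ereal_tendsto_simps laguerre_weight_def)
  qed (auto simp: laguerre_weight_def einterval_def)
  then show ?thesis by simp
qed

lemma pearson_functional_jacobi:
  assumes "has_moments (-1) 1 (jacobi_weight \<alpha> \<beta>)" and \<alpha>: "\<alpha> > -1" and \<beta>: "\<beta> > -1"
  shows "pearson_functional (weight_functional (-1) 1 (jacobi_weight \<alpha> \<beta>)) 1 0 (-1)
    (of_real (\<beta> - \<alpha>)) (of_real (- (\<alpha> + \<beta> + 2)))"
proof -
  have "pearson_functional (weight_functional (-1) 1 (jacobi_weight \<alpha> \<beta>))
    (of_real 1) (of_real 0) (of_real (-1)) (of_real (\<beta> - \<alpha>)) (of_real (- (\<alpha> + \<beta> + 2)))"
  proof (rule pearson_functional_weight[OF assms(1)])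
    have I: "einterval (-1) 1 = {-1<..<1::real}"
      by (auto simp: einterval_def one_ereal_def)
    show "((\<lambda>x. (1 + 0 * x + -1 * x\<^sup>2) * jacobi_weight \<alpha> \<beta> x) has_real_derivative
        (\<beta> - \<alpha> + - (\<alpha> + \<beta> + 2) * x) * jacobi_weight \<alpha> \<beta> x) (at x)" if "x \<in> einterval (-1) 1" for x
    proof -
      have x: "1 - x > 0" "1 + x > 0" using that by (auto simp: I)
      define A B where "A = (1 - x) powr \<alpha>" and "B = (1 + x) powr \<beta>"
      have dA: "((\<lambda>x. (1 - x) powr \<alpha>) has_real_derivative - \<alpha> * (A / (1 - x))) (at x)"
        using x by (auto intro!: derivative_eq_intros simp: A_def powr_diff)
      have dB: "((\<lambda>x. (1 + x) powr \<beta>) has_real_derivative \<beta> * (B / (1 + x))) (at x)"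
        using x by (auto intro!: derivative_eq_intros simp: B_def powr_diff)
      have d\<rho>: "((\<lambda>x. 1 + 0 * x + -1 * x\<^sup>2) has_real_derivative - 2 * x) (at x)"
        by (auto intro!: derivative_eq_intros)
      have cancel: "(1 + 0 * x + -1 * x\<^sup>2) * (A / (1 - x)) = (1 + x) * A"
        "(1 + 0 * x + -1 * x\<^sup>2) * (B / (1 + x)) = (1 - x) * B"
        using x by (simp_all add: field_simps power2_eq_square)
      have regroup: "- 2 * x * (A * B) + (- \<alpha> * A' * B + \<beta> * B' * A) * r =
          - 2 * x * (A * B) - \<alpha> * (r * A') * B + \<beta> * (r * B') * A" for A' B' r
        by (simp add: algebra_simps)
      have "- 2 * x * (A * B) + (- \<alpha> * (A / (1 - x)) * B + \<beta> * (B / (1 + x)) * A) * (1 + 0 * x + -1 * x\<^sup>2) =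
          - 2 * x * (A * B) - \<alpha> * ((1 + 0 * x + -1 * x\<^sup>2) * (A / (1 - x))) * B +
          \<beta> * ((1 + 0 * x + -1 * x\<^sup>2) * (B / (1 + x))) * A"
        by (rule regroup)
      also have "\<dots> = (\<beta> - \<alpha> + - (\<alpha> + \<beta> + 2) * x) * (A * B)"
        unfolding cancel by (simp add: algebra_simps)
      finally show ?thesis
        using DERIV_mult[OF d\<rho> DERIV_mult[OF dA dB]]
        unfolding jacobi_weight_def A_def B_def by simp
    qed
    show "isCont (jacobi_weight \<alpha> \<beta>) x" if "x \<in> einterval (-1) 1" for x
      using that unfolding jacobi_weight_def I by (auto intro!: continuous_intros)
    show "(((\<lambda>x. (1 + 0 * x + -1 * x\<^sup>2) * jacobi_weight \<alpha> \<beta> x * x ^ k) \<circ> real_of_ereal) \<longlongrightarrow> 0)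
        (at_right (-1))" for k
    proof -
      have "((\<lambda>x::real. (1 + x) powr (\<beta> + 1)) \<longlongrightarrow> 0) (at_right (-1))"
        using \<beta> by real_asymp
      moreover have "((\<lambda>x::real. (1 - x) * (1 - x) powr \<alpha> * x ^ k) \<longlongrightarrow>
          (1 - (-1)) * (1 - (-1)) powr \<alpha> * (-1) ^ k) (at_right (-1))"
        by (intro tendsto_intros) auto
      ultimately have "((\<lambda>x. (1 + x) powr (\<beta> + 1) * ((1 - x) * (1 - x) powr \<alpha> * x ^ k)) \<longlongrightarrow>
          0 * ((1 - (-1)) * (1 - (-1)) powr \<alpha> * (-1) ^ k)) (at_right (-1))"
        by (rule tendsto_mult)
      moreover have "\<forall>\<^sub>F x in at_right (-1). (1 + x) powr (\<beta> + 1) * ((1 - x) * (1 - x) powr \<alpha> * x ^ k) =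
          (1 + 0 * x + -1 * x\<^sup>2) * jacobi_weight \<alpha> \<beta> x * x ^ k"
        using eventually_at_right_less[of "-1::real"]
        by eventually_elim (simp add: jacobi_weight_def powr_add power2_eq_square algebra_simps)
      ultimately have "((\<lambda>x. (1 + 0 * x + -1 * x\<^sup>2) * jacobi_weight \<alpha> \<beta> x * x ^ k) \<longlongrightarrow> 0) (at_right (-1))"
        by (simp add: tendsto_cong)
      then have "(((\<lambda>x. (1 + 0 * x + -1 * x\<^sup>2) * jacobi_weight \<alpha> \<beta> x * x ^ k) \<circ> real_of_ereal) \<longlongrightarrow> 0)
          (at_right (ereal (-1)))"
        unfolding ereal_tendsto_simps .
      then show ?thesis by (simp add: one_ereal_def)
    qed
    show "(((\<lambda>x. (1 + 0 * x + -1 * x\<^sup>2) * jacobi_weight \<alpha> \<beta> x * x ^ k) \<circ> real_of_ereal) \<longlongrightarrow> 0)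
        (at_left 1)" for k
    proof -
      have "((\<lambda>x::real. (1 - x) powr (\<alpha> + 1)) \<longlongrightarrow> 0) (at_left 1)"
        using \<alpha> by real_asymp
      moreover have "((\<lambda>x::real. (1 + x) * (1 + x) powr \<beta> * x ^ k) \<longlongrightarrow>
          (1 + 1) * (1 + 1) powr \<beta> * 1 ^ k) (at_left 1)"
        by (intro tendsto_intros) auto
      ultimately have "((\<lambda>x. (1 - x) powr (\<alpha> + 1) * ((1 + x) * (1 + x) powr \<beta> * x ^ k)) \<longlongrightarrow>
          0 * ((1 + 1) * (1 + 1) powr \<beta> * 1 ^ k)) (at_left 1)"
        by (rule tendsto_mult)
      moreover have "\<forall>\<^sub>F x in at_left 1. x < (1::real)"
        by (simp add: eventually_at_filter)
      then have "\<forall>\<^sub>F x in at_left 1. (1 - x) powr (\<alpha> + 1) * ((1 + x) * (1 + x) powr \<beta> * x ^ k) =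
          (1 + 0 * x + -1 * x\<^sup>2) * jacobi_weight \<alpha> \<beta> x * x ^ k"
        by eventually_elim (simp add: jacobi_weight_def powr_add power2_eq_square algebra_simps)
      ultimately have "((\<lambda>x. (1 + 0 * x + -1 * x\<^sup>2) * jacobi_weight \<alpha> \<beta> x * x ^ k) \<longlongrightarrow> 0) (at_left 1)"
        by (simp add: tendsto_cong)
      then show ?thesis unfolding one_ereal_def ereal_tendsto_simps .
    qed
    show "0 < jacobi_weight \<alpha> \<beta> x" if "x \<in> einterval (-1) 1" for x
      using that by (simp add: jacobi_weight_def I)
    show "{0<..<1} \<subseteq> einterval (-1) 1"
      by (auto simp: I)
  qed
  then show ?thesis by simp
qed

section \<open>Orthogonal polynomials of a direct sum\<close>

text \<open>
  A matrix is the sum of its entries placed at their positions, and placing is bounded linear.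
\<close>

lemma integrable_matrix:
  fixes F :: "real \<Rightarrow> 'n::finite cmat"
  assumes "\<And>i j. integrable M (\<lambda>x. F x $ i $ j)"
  shows "integrable M F"
proof -
  have "linear (\<lambda>z. axis i (axis j z) :: 'n cmat)" for i j
    by (intro linearI) (simp_all add: vec_eq_iff axis_def)
  then have "bounded_linear (\<lambda>z. axis i (axis j z) :: 'n cmat)" for i j
    by (simp add: linear_conv_bounded_linear)
  then have "integrable M (\<lambda>x. axis i (axis j (F x $ i $ j)) :: 'n cmat)" for i j
    using assms by (rule integrable_bounded_linear)
  then have "integrable M (\<lambda>x. \<Sum>i\<in>UNIV. \<Sum>j\<in>UNIV. axis i (axis j (F x $ i $ j)) :: 'n cmat)"
    by (intro Bochner_Integration.integrable_sum)
  moreover have "(\<Sum>i\<in>UNIV. \<Sum>j\<in>UNIV. axis i (axis j (A $ i $ j))) = A" for A :: "'n cmat"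
  proof -
    have "(\<Sum>i\<in>UNIV. \<Sum>j\<in>UNIV. axis i (axis j (A $ i $ j))) $ k $ l = A $ k $ l" for k l
    proof -
      have "(\<Sum>i\<in>UNIV. \<Sum>j\<in>UNIV. axis i (axis j (A $ i $ j))) $ k $ l =
          (\<Sum>i\<in>UNIV. \<Sum>j\<in>UNIV. if i = k then (if j = l then A $ i $ j else 0) else 0)"
        unfolding sum_component by (intro sum.cong) (auto simp: axis_def)
      also have "\<dots> = (\<Sum>i\<in>UNIV. if i = k then A $ i $ l else 0)"
        by (intro sum.cong) auto
      finally show ?thesis by simp
    qed
    then show ?thesis by (simp add: vec_eq_iff)
  qed
  ultimately show ?thesis by simp
qed

lemma set_integral_matrix_nth:
  fixes F :: "real \<Rightarrow> 'n::finite cmat"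
  assumes "\<And>i j. set_integrable M S (\<lambda>x. F x $ i $ j)"
  shows "(LINT x:S|M. F x) $ i $ j = (LINT x:S|M. F x $ i $ j)"
proof -
  have "integrable M (\<lambda>x. indicator S x *\<^sub>R F x)"
    using assms by (intro integrable_matrix) (simp add: set_integrable_def)
  moreover have "bounded_linear (\<lambda>A :: 'n cmat. A $ i $ j)"
    using bounded_linear_compose[OF bounded_linear_vec_nth bounded_linear_vec_nth] .
  ultimately show ?thesis
    using integral_bounded_linear[of "\<lambda>A :: 'n cmat. A $ i $ j" M "\<lambda>x. indicator S x *\<^sub>R F x"]
    by (simp add: set_lebesgue_integral_def)
qed

lemma has_moments_direct_sum:
  assumes "weight_matrix x0 x1 (direct_sum_weight w)"
  shows "has_moments x0 x1 (w i)"
  unfolding has_moments_def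
proof
  fix k
  have "set_integrable lborel (einterval x0 x1) (\<lambda>x. x ^ k *\<^sub>R direct_sum_weight w x)"
    using assms unfolding weight_matrix_def finite_moments_def by blast
  moreover have "bounded_linear (\<lambda>A. Re (A $ i $ i))"
    using bounded_linear_compose[OF bounded_linear_Re
        bounded_linear_compose[OF bounded_linear_vec_nth bounded_linear_vec_nth]] .
  ultimately have "integrable lborel (\<lambda>x. Re ((indicator (einterval x0 x1) x *\<^sub>R (x ^ k *\<^sub>R direct_sum_weight w x)) $ i $ i))"
    unfolding set_integrable_def by (rule integrable_bounded_linear[rotated])
  then show "set_integrable lborel (einterval x0 x1) (\<lambda>x. x ^ k * w i x)"
    unfolding set_integrable_def by (simp add: direct_sum_weight_def mult.assoc)
qed

text \<open>
  Against a diagonal of real polynomials the matrix form splits into the scalar functionals, one for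
  each column; the conjugation in the adjoint disappears.
\<close>

lemma sesq_form_direct_sum_nth:
  assumes mom: "\<And>j. has_moments x0 x1 (w j)" and real: "\<And>j. real_poly (q j m)"
  shows "sesq_form x0 x1 (direct_sum_weight w) P (diag_sequence q m) $ i $ j =
    weight_functional x0 x1 (w j) (P $ i $ j * q j m)"
proof -
  have adj: "adjoint_mat (mpoly_eval (diag_sequence q m) x) = diag_mat (\<lambda>j. poly (q j m) (of_real x))" for x
  proof -
    have "cnj (poly (q j m) (of_real x)) = poly (q j m) (of_real x)" for j
      by (subst (1 2) real_poly_of_real[OF real]) simp
    then show ?thesis
      by (simp add: vec_eq_iff adjoint_mat_def mpoly_eval_def diag_sequence_def diag_mat_nth transpose_def)
  qed
  have W: "direct_sum_weight w x = diag_mat (\<lambda>j. of_real (w j x))" for x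
    by (simp add: direct_sum_weight_def diag_mat_def)
  have entry: "(mpoly_eval P x ** direct_sum_weight w x ** adjoint_mat (mpoly_eval (diag_sequence q m) x)) $ i $ j =
      poly (P $ i $ j * q j m) (of_real x) * of_real (w j x)" for x i j
    unfolding adj W mult_diag_mat_nth by (simp add: mpoly_eval_def)
  show ?thesis
    unfolding sesq_form_def weight_functional_def
    by (subst set_integral_matrix_nth) (simp_all only: entry poly_weight_integrable[OF mom])
qed

text \<open>
  Orthogonality to \<open>p (n - 1)\<close> removes the leading coefficient, because the rest of \<open>f\<close> is
  orthogonal to \<open>p (n - 1)\<close> anyway; then the degree goes down.
\<close>

lemma (in pearson_functional) eq_0_if_orthogonal:
  assumes deg: "\<And>n. degree (p n) = n" and lead: "\<And>n. coeff (p n) n = 1" and real: "\<And>n. real_poly (p n)"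
    and orth: "\<And>n f. (\<forall>k\<ge>n. coeff f k = 0) \<Longrightarrow> L (p n * f) = 0"
    and "\<forall>k\<ge>n. coeff f k = 0" and "\<And>m. m < n \<Longrightarrow> L (f * p m) = 0"
  shows "f = 0"
  using assms(5,6)
proof (induction n)
  case 0
  then show ?case by (simp add: poly_eq_iff)
next
  case (Suc n)
  define g where "g = f - smult (coeff f n) (p n)"
  have "\<forall>k\<ge>n. coeff g k = 0"
  proof (intro allI impI)
    fix k assume "k \<ge> n"
    then show "coeff g k = 0"
      using Suc.prems(1) lead[of n] deg[of n] by (cases "k = n") (auto simp: g_def coeff_eq_0)
  qed
  then have "L (p n * g) = 0" by (rule orth)
  moreover have "L (f * p n) = L (p n * g) + coeff f n * L (p n * p n)"
    by (simp add: g_def right_diff_distrib L_diff L_smult mult.commute)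
  ultimately have "coeff f n * L (p n * p n) = 0"
    using Suc.prems(2)[of n] by simp
  moreover have "p n \<noteq> 0" using lead[of n] by auto
  ultimately have "coeff f n = 0"
    using L_definite[OF real[of n]] by simp
  have "\<forall>k\<ge>n. coeff f k = 0"
  proof (intro allI impI)
    fix k assume "k \<ge> n"
    then show "coeff f k = 0"
      using Suc.prems(1) \<open>coeff f n = 0\<close> by (cases "k = n") auto
  qed
  then show ?case using Suc.IH Suc.prems(2) by simp
qed

text \<open>
  For uniqueness, the difference of two candidates in degree \<open>n\<close> has lower degree and, as the
  candidates agree in lower degrees, it is orthogonal to those; hence its entries vanish.
\<close>

lemma monic_ops_direct_sum:
  fixes w :: "'n::finite \<Rightarrow> real \<Rightarrow> real" and q :: "'n \<Rightarrow> nat \<Rightarrow> complex poly"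
  assumes mom: "\<And>j. has_moments x0 x1 (w j)"
    and pf: "\<And>j. pearson_functional (weight_functional x0 x1 (w j)) (r0 j) (r1 j) (r2 j) (t0 j) (t1 j)"
    and deg: "\<And>j n. degree (q j n) = n" and lead: "\<And>j n. coeff (q j n) n = 1"
    and real: "\<And>j n. real_poly (q j n)"
    and orth: "\<And>j n f. (\<forall>k\<ge>n. coeff f k = 0) \<Longrightarrow> weight_functional x0 x1 (w j) (q j n * f) = 0"
  shows "monic_ops x0 x1 (direct_sum_weight w) = diag_sequence q"
proof -
  let ?W = "direct_sum_weight w"
  note sesq = sesq_form_direct_sum_nth[where w = w and q = q, OF mom real]
  have monic: "monic_sequence (diag_sequence q)"
    by (rule monic_sequence_diag_sequence) (fact deg lead)+
  have zero: "weight_functional x0 x1 (w j) 0 = 0" for j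
    using pearson_functional.L_0[OF pf] .
  have "monic_orthogonal x0 x1 ?W (diag_sequence q)"
    unfolding monic_orthogonal_def
  proof (intro conjI allI impI)
    show "mpoly_coeff (diag_sequence q n) n = mat 1" for n
      using monic by (simp add: monic_sequence_def)
    have "(mat 1 :: 'n cmat) \<noteq> 0"
      by (simp add: vec_eq_iff mat_nth)
    then show "mpoly_degree (diag_sequence q n) = n" for n
      using monic by (intro mpoly_degree_eqI) (auto simp: monic_sequence_def)
    show "sesq_form x0 x1 ?W (diag_sequence q n) (diag_sequence q m) = 0" if "n \<noteq> m" for n m
    proof -
      have "weight_functional x0 x1 (w j) (q j n * q j m) = 0" for j
      proof (cases "m < n")
        case True
        then show ?thesis using deg by (intro orth) (simp add: coeff_eq_0)
      next
        case False
        with that have "weight_functional x0 x1 (w j) (q j m * q j n) = 0"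
          using deg by (intro orth) (simp add: coeff_eq_0)
        then show ?thesis by (simp add: mult.commute)
      qed
      then show ?thesis
        by (simp add: vec_eq_iff sesq) (simp add: diag_sequence_def zero)
    qed
  qed
  moreover have "P = diag_sequence q" if P: "monic_orthogonal x0 x1 ?W P" for P
  proof
    fix n
    show "P n = diag_sequence q n"
    proof (induction n rule: less_induct)
      case (less n)
      have "P n $ i $ j - diag_sequence q n $ i $ j = 0" for i j
      proof (rule pearson_functional.eq_0_if_orthogonal[OF pf, where p = "q j" and n = n])
        let ?f = "P n $ i $ j - diag_sequence q n $ i $ j"
        have "mpoly_coeff (P n) k = mpoly_coeff (diag_sequence q n) k" if "k \<ge> n" for k
        proof (cases "k = n")
          case True
          then show ?thesis using P monic by (simp add: monic_orthogonal_def monic_sequence_def)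
        next
          case False
          with that have "k > n" by simp
          then have "mpoly_coeff (P n) k = 0"
            using P by (intro mpoly_coeff_eq_0) (simp add: monic_orthogonal_def)
          moreover have "mpoly_coeff (diag_sequence q n) k = 0"
            using monic \<open>k > n\<close> by (simp add: monic_sequence_def)
          ultimately show ?thesis by simp
        qed
        then show "\<forall>k\<ge>n. coeff ?f k = 0"
          by (simp add: vec_eq_iff)
        fix m assume "m < n"
        then have "P m = diag_sequence q m" by (rule less)
        have "sesq_form x0 x1 ?W (P n) (diag_sequence q m) = 0"
          using P \<open>m < n\<close> \<open>P m = diag_sequence q m\<close> unfolding monic_orthogonal_def by (metis less_irrefl)
        moreover have "sesq_form x0 x1 ?W (diag_sequence q n) (diag_sequence q m) = 0"
          using \<open>monic_orthogonal x0 x1 ?W (diag_sequence q)\<close> \<open>m < n\<close>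
          unfolding monic_orthogonal_def by (metis less_irrefl)
        ultimately have "weight_functional x0 x1 (w j) (P n $ i $ j * q j m) = 0"
          "weight_functional x0 x1 (w j) (diag_sequence q n $ i $ j * q j m) = 0"
          by (simp_all add: sesq[symmetric])
        then show "weight_functional x0 x1 (w j) (?f * q j m) = 0"
          by (simp add: left_diff_distrib pearson_functional.L_diff[OF pf])
      qed (fact deg lead real orth)+
      then show ?case by (simp add: vec_eq_iff)
    qed
  qed
  ultimately show ?thesis
    unfolding monic_ops_def by (rule the_equality)
qed

section \<open>Darboux transformations through the center\<close>

text \<open>
  The factor \<open>V\<close> is kept, so the polynomials of \<open>W\<close> stay the same; only \<open>N\<close> is multiplied by an
  operator that makes the product central.
\<close>

lemma darboux_through_center:
  fixes w :: "'n::finite \<Rightarrow> real \<Rightarrow> real"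
  assumes darboux: "darboux_equivalent x0 x1 W (direct_sum_weight w)"
    and ops: "monic_ops x0 x1 (direct_sum_weight w) = diag_sequence q"
    and q: "intertwined_eigenfunctions q \<rho> \<tau> e \<kappa>"
  shows "\<exists>V N (A :: nat \<Rightarrow> 'n cmat).
    degree_preserving V \<and> degree_preserving N \<and>
    op_prod V N \<in> D_center x0 x1 (direct_sum_weight w) \<and>
    (\<forall>n. V (monic_ops x0 x1 (direct_sum_weight w) n) = const_mpoly (A n) ** monic_ops x0 x1 W n)"
proof -
  interpret intertwined_eigenfunctions q \<rho> \<tau> e \<kappa> by (rule q)
  have algebra: "D \<in> D_algebra x0 x1 (direct_sum_weight w) \<longleftrightarrow> (\<exists>\<Lambda>. has_eigenvalues P D \<Lambda>)" for D
    unfolding D_algebra_def has_eigenvalues_def ops by (auto simp: choice_iff)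
  from darboux obtain V N A where
    D: "op_prod V N \<in> D_algebra x0 x1 (direct_sum_weight w)"
    and V: "degree_preserving V" and N: "degree_preserving N"
    and A: "\<And>n. V (monic_ops x0 x1 (direct_sum_weight w) n) = const_mpoly (A n) ** monic_ops x0 x1 W n"
    unfolding darboux_equivalent_def darboux_transformation_def by auto
  obtain \<Lambda> where \<Lambda>: "has_eigenvalues P (op_prod V N) \<Lambda>"
    using D algebra by blast
  obtain E \<Theta> where E: "degree_preserving E" and \<Theta>: "has_eigenvalues P (op_prod (op_prod V N) E) \<Theta>"
    and comm: "\<And>F \<Phi>. has_eigenvalues P F \<Phi> \<Longrightarrow>
      op_prod (op_prod (op_prod V N) E) F = op_prod F (op_prod (op_prod V N) E)"
    using central_multiple_of_operator[OF \<Lambda> degree_preserving_op_prod[OF V N]] by blast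
  have "op_prod V (op_prod N E) = op_prod (op_prod V N) E"
    by (simp add: op_prod_def)
  then have "op_prod V (op_prod N E) \<in> D_center x0 x1 (direct_sum_weight w)"
    unfolding D_center_def using algebra \<Theta> comm by auto
  with V degree_preserving_op_prod[OF N E] A show ?thesis by blast
qed

text \<open>
  The endpoints determine the family, so all weights are of the same type and share \<open>\<rho>\<close>. For
  Hermite and Laguerre weights the intertwiners are handled by leading coefficients, for Jacobi
  weights by values at the endpoint.
\<close>

theorem theorem4p2:
  fixes x0 x1 :: ereal
    and W :: "real \<Rightarrow> complex ^ 'n::finite ^ 'n"
    and w :: "'n \<Rightarrow> real \<Rightarrow> real"
  assumes "weight_matrix x0 x1 W"
    and "\<And>i. classical_weight x0 x1 (w i)"
    and "darboux_equivalent x0 x1 W (direct_sum_weight w)"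
  shows "\<exists>V N (A :: nat \<Rightarrow> complex ^ 'n ^ 'n).
    degree_preserving V \<and> degree_preserving N \<and>
    op_prod V N \<in> D_center x0 x1 (direct_sum_weight w) \<and>
    (\<forall>n. V (monic_ops x0 x1 (direct_sum_weight w) n) =
         const_mpoly (A n) ** monic_ops x0 x1 W n)"
proof -
  have mom: "has_moments x0 x1 (w j)" for j
    using assms(3) unfolding darboux_equivalent_def darboux_transformation_def
    by (intro has_moments_direct_sum) blast
  have reduce: "?thesis"
    if pf: "\<And>j. pearson_functional (weight_functional x0 x1 (w j)) r0 r1 r2 (t0 j) (t1 j)"
      and inter: "\<And>q. (\<And>j n. degree (q j n) = n) \<Longrightarrow> (\<And>j n. coeff (q j n) n = 1) \<Longrightarrow>
        (\<And>j n. pderiv (pderiv (q j n)) * [:r0, r1, r2:] + pderiv (q j n) * [:t0 j, t1 j:] =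
          smult ((r2 * (of_nat n - 1) + t1 j) * of_nat n) (q j n)) \<Longrightarrow>
        \<exists>\<rho> \<tau> e \<kappa>. intertwined_eigenfunctions q \<rho> \<tau> e \<kappa>"
    for r0 r1 r2 and t0 t1 :: "'n \<Rightarrow> complex"
  proof -
    have "\<forall>j. \<exists>p. (\<forall>n. degree (p n) = n) \<and> (\<forall>n. coeff (p n) n = 1) \<and> (\<forall>n. real_poly (p n)) \<and>
        (\<forall>n f. (\<forall>k\<ge>n. coeff f k = 0) \<longrightarrow> weight_functional x0 x1 (w j) (p n * f) = 0) \<and>
        (\<forall>n. pderiv (pderiv (p n)) * [:r0, r1, r2:] + pderiv (p n) * [:t0 j, t1 j:] =
          smult ((r2 * (of_nat n - 1) + t1 j) * of_nat n) (p n))"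
      by (intro allI pearson_functional.orthogonal_eigenfunctions[OF pf])
    from choice[OF this] obtain q where
      q: "\<And>j n. degree (q j n) = n" "\<And>j n. coeff (q j n) n = 1" "\<And>j n. real_poly (q j n)"
        "\<And>j n f. (\<forall>k\<ge>n. coeff f k = 0) \<Longrightarrow> weight_functional x0 x1 (w j) (q j n * f) = 0"
        "\<And>j n. pderiv (pderiv (q j n)) * [:r0, r1, r2:] + pderiv (q j n) * [:t0 j, t1 j:] =
          smult ((r2 * (of_nat n - 1) + t1 j) * of_nat n) (q j n)"
      by blast
    have "monic_ops x0 x1 (direct_sum_weight w) = diag_sequence q"
      by (rule monic_ops_direct_sum[OF mom pf q(1-4)])
    moreover obtain \<rho> \<tau> e \<kappa> where "intertwined_eigenfunctions q \<rho> \<tau> e \<kappa>"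
      using inter[OF q(1,2,5)] by blast
    ultimately show ?thesis
      using darboux_through_center[OF assms(3)] by blast
  qed
  consider (hermite) "x0 = - \<infinity>" "x1 = \<infinity>" | (laguerre) "x0 = 0" "x1 = \<infinity>" | (jacobi) "x0 = -1" "x1 = 1"
    using assms(2) unfolding classical_weight_def by blast
  then show ?thesis
  proof cases
    case hermite
    have "\<exists>b. \<forall>x\<in>einterval x0 x1. w j x = hermite_weight b x" for j
      using assms(2)[of j] hermite unfolding classical_weight_def by auto
    then obtain b where b: "\<And>j x. x \<in> einterval x0 x1 \<Longrightarrow> w j x = hermite_weight (b j) x"
      by metis
    show ?thesis
    proof (rule reduce)
      show "pearson_functional (weight_functional x0 x1 (w j)) 1 0 0 (of_real (2 * b j)) (-2)" for j
        using pearson_functional_hermite[of "b j"] mom[of j] b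
          weight_functional_cong[of x0 x1 "w j" "hermite_weight (b j)"]
          has_moments_cong[of x0 x1 "w j" "hermite_weight (b j)"]
        unfolding hermite by simp
      fix q :: "'n \<Rightarrow> nat \<Rightarrow> complex poly"
      assume q: "\<And>j n. degree (q j n) = n" "\<And>j n. coeff (q j n) n = 1"
        "\<And>j n. pderiv (pderiv (q j n)) * [:1, 0, 0:] + pderiv (q j n) * [:of_real (2 * b j), -2:] =
          smult ((0 * (of_nat n - 1) + -2) * of_nat n) (q j n)"
      have "intertwined_eigenfunctions q (\<lambda>j. [:1, 0, 0:]) (\<lambda>j. [:of_real (2 * b j), -2:])
          (\<lambda>j n. -2 * of_nat n) (\<lambda>j n. 1)"
        by (rule intertwined_eigenfunctions_linear) (use q in simp_all)
      then show "\<exists>\<rho> \<tau> e \<kappa>. intertwined_eigenfunctions q \<rho> \<tau> e \<kappa>" by blast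
    qed
  next
    case laguerre
    have "\<exists>\<alpha>>-1. \<forall>x\<in>einterval x0 x1. w j x = laguerre_weight \<alpha> x" for j
      using assms(2)[of j] laguerre unfolding classical_weight_def by auto
    then obtain \<alpha> where \<alpha>: "\<And>j. \<alpha> j > -1"
      "\<And>j x. x \<in> einterval x0 x1 \<Longrightarrow> w j x = laguerre_weight (\<alpha> j) x"
      by metis
    show ?thesis
    proof (rule reduce)
      show "pearson_functional (weight_functional x0 x1 (w j)) 0 1 0 (of_real (\<alpha> j + 1)) (-1)" for j
        using pearson_functional_laguerre[of "\<alpha> j"] mom[of j] \<alpha>
          weight_functional_cong[of x0 x1 "w j" "laguerre_weight (\<alpha> j)"]
          has_moments_cong[of x0 x1 "w j" "laguerre_weight (\<alpha> j)"]
        unfolding laguerre by simp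
      fix q :: "'n \<Rightarrow> nat \<Rightarrow> complex poly"
      assume q: "\<And>j n. degree (q j n) = n" "\<And>j n. coeff (q j n) n = 1"
        "\<And>j n. pderiv (pderiv (q j n)) * [:0, 1, 0:] + pderiv (q j n) * [:of_real (\<alpha> j + 1), -1:] =
          smult ((0 * (of_nat n - 1) + -1) * of_nat n) (q j n)"
      have "intertwined_eigenfunctions q (\<lambda>j. [:0, 1, 0:]) (\<lambda>j. [:of_real (\<alpha> j + 1), -1:])
          (\<lambda>j n. -1 * of_nat n) (\<lambda>j n. 1)"
        by (rule intertwined_eigenfunctions_linear) (use q in simp_all)
      then show "\<exists>\<rho> \<tau> e \<kappa>. intertwined_eigenfunctions q \<rho> \<tau> e \<kappa>" by blast
    qed
  next
    case jacobi
    have "\<exists>\<alpha>>-1. \<exists>\<beta>>-1. \<forall>x\<in>einterval x0 x1. w j x = jacobi_weight \<alpha> \<beta> x" for j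
      using assms(2)[of j] jacobi unfolding classical_weight_def by auto
    then obtain \<alpha> \<beta> where \<alpha>: "\<And>j. \<alpha> j > -1" and \<beta>: "\<And>j. \<beta> j > -1"
      and w: "\<And>j x. x \<in> einterval x0 x1 \<Longrightarrow> w j x = jacobi_weight (\<alpha> j) (\<beta> j) x"
      by metis
    show ?thesis
    proof (rule reduce)
      show "pearson_functional (weight_functional x0 x1 (w j)) 1 0 (-1)
          (of_real (\<beta> j - \<alpha> j)) (of_real (- (\<alpha> j + \<beta> j + 2)))" for j
        using pearson_functional_jacobi[of "\<alpha> j" "\<beta> j"] mom[of j] \<alpha> \<beta> w
          weight_functional_cong[of x0 x1 "w j" "jacobi_weight (\<alpha> j) (\<beta> j)"]
          has_moments_cong[of x0 x1 "w j" "jacobi_weight (\<alpha> j) (\<beta> j)"]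
        unfolding jacobi by simp
      fix q :: "'n \<Rightarrow> nat \<Rightarrow> complex poly"
      assume q: "\<And>j n. degree (q j n) = n" "\<And>j n. coeff (q j n) n = 1"
        and ode: "\<And>j n. pderiv (pderiv (q j n)) * [:1, 0, -1:] +
          pderiv (q j n) * [:of_real (\<beta> j - \<alpha> j), of_real (- (\<alpha> j + \<beta> j + 2)):] =
          smult (((-1) * (of_nat n - 1) + of_real (- (\<alpha> j + \<beta> j + 2))) * of_nat n) (q j n)"
      define s :: "'n \<Rightarrow> complex" where "s j = of_real (\<alpha> j + \<beta> j + 1)" for j
      define t0 :: "'n \<Rightarrow> complex" where "t0 j = of_real (\<beta> j - \<alpha> j)" for j
      have "intertwined_eigenfunctions q (\<lambda>j. [:1, 0, -1:]) (\<lambda>j. [:t0 j, - 1 - s j:])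
          (\<lambda>j n. - (of_nat n * (of_nat n + s j))) (\<lambda>j n. poly (q j n) 1)"
      proof (rule intertwined_eigenfunctions_jacobi)
        have t1: "of_real (- (\<alpha> j + \<beta> j + 2)) = - 1 - s j" for j
          by (simp add: s_def)
        show "pderiv (pderiv (q j n)) * [:1, 0, -1:] + pderiv (q j n) * [:t0 j, - 1 - s j:] =
            smult (- (of_nat n * (of_nat n + s j))) (q j n)" for j n
        proof -
          have "((-1) * (of_nat n - 1) + (- 1 - s j)) * of_nat n = - (of_nat n * (of_nat n + s j))"
            by (simp add: algebra_simps)
          then show ?thesis
            using ode[of j n] unfolding t1 t0_def[symmetric] by simp
        qed
        show "t0 j + (- 1 - s j) - 2 * of_nat k \<noteq> 0" for j and k :: nat
        proof -
          have "t0 j + (- 1 - s j) - 2 * of_nat k = of_real (- 2 * (\<alpha> j + 1 + real k))"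
            by (simp add: t0_def s_def)
          moreover have "\<alpha> j + 1 + real k > 0" using \<alpha>[of j] by simp
          ultimately show ?thesis by (simp only: of_real_eq_0_iff) simp
        qed
      qed (fact q)+
      then show "\<exists>\<rho> \<tau> e \<kappa>. intertwined_eigenfunctions q \<rho> \<tau> e \<kappa>" by blast
    qed
  qed
qed

end
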